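(* Let $K:\mathbb{R}^n\setminus\{0\}\to[0,\infty)$ be measurable, even, radial, and non-increasing in $|r|$, and assume $$\int_{\mathbb{R}^n}(1\wedge|r|^2)\,K(r)\,dr<\infty.$$ Let $u:\mathbb{R}^n\times[0,\infty)\to\mathbb{R}$ be sufficiently smooth (in particular continuous on $\mathbb{R}^n\times[0,\infty)$) and satisfy: (i) $u$ is bounded, with $\|u\|_{L^\infty(\mathbb{R}^n\times[0,\infty))}\le1$; (ii) for each $t>0$, $u(\cdot,t)\in C^{1,1}_{\mathrm{loc}}(\mathbb{R}^n)$; and (iii) the equation $u_t(x,t)=L_Ku(\cdot,t)(x)$ for all $(x,t)\in\mathbb{R}^n\times(0,\infty)$ holds in the pointwise classical sense. Let $\varphi:[0,\infty)\times[0,\infty)\to[0,\infty)$ satisfy: (a) for each $t\ge0$, the map $r\mapsto\varphi(r,t)$ belongs to $C^1([0,\infty))$, is strictly increasing, and satisfies $\varphi(0,t)=0$; (b) $\varphi(\cdot,0)$ is a modulus of continuity for $u(\cdot,0)$; and (c) for each $t>0$, the odd extension $\tilde\varphi(r,t):=\varphi(r,t)$ for $r\ge0$, $\tilde\varphi(r,t):=-\varphi(-r,t)$ for $r<0$, belongs to $C^{1,1}_{\mathrm{loc}}(\mathbb{R})$ (as a function of $r$), satisfies $\lim_{r\to\pm\infty}\tilde\varphi(r,t)=\pm1$, and solves $$\tilde\varphi_t(s,t)=\mathrm{PV}\int_{\mathbb{R}}\tilde K(w)\bigl(\tilde\varphi(s+w,t)-\tilde\varphi(s,t)\bigr)\,dw,$$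 where $\tilde K:\mathbb{R}\setminus\{0\}\to[0,\infty)$, $\tilde K(w):=\int_{\mathbb{R}^{n-1}}K(w,p)\,dp$ for $w\ne0$. Assume further that there exists a smooth radial function $\Psi:\mathbb{R}^n\to[1,\infty)$ such that $\Psi(x)\to\infty$ as $|x|\to\infty$, and such that $L_K\Psi(x)$ exists for every $x\in\mathbb{R}^n$ and satisfies $$\sup_{x\in\mathbb{R}^n}L_K\Psi(x)\le K_0<\infty.$$ Then, for every $t\ge0$, the function $\varphi(\cdot,t)$ is a modulus of continuity for $u(\cdot,t)$: $$|u(y,t)-u(x,t)|\le2\varphi\left(\frac{|x-y|}{2},t\right)\qquad\text{for all }x,y\in\mathbb{R}^n.$$
   Context: For any function $f$ for which the following principal-value limit exists, write $$L_Kf(x):=\mathrm{PV}\int_{\mathbb{R}^n}K(r)\bigl(f(x+r)-f(x)\bigr)\,dr:=\lim_{\delta\downarrow0}\int_{|r|>\delta}K(r)\bigl(f(x+r)-f(x)\bigr)\,dr.$$ The one-dimensional principal value is defined in the same way, as the limit of integrals over $|w|>\delta$. Here $1\wedge|r|^2=\min\{1,|r|^2\}$, and points of $\mathbb{R}^n$ are written $(w,p)$ with $w\in\mathbb{R}$, $p\in\mathbb{R}^{n-1}$. A function $\omega:[0,\infty)\to[0,\infty)$ is a modulus of continuity for $f:\mathbb{R}^n\to\mathbb{R}$ if $\omega$ is continuous at zero and vanishes there, and $|f(y)-f(x)|\le2\omega\left(\frac{|y-x|}{2}\right)$ for all $x,y\in\mathbb{R}^n$.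
   Formalization: Adds the assumption that φ(r,t) → φ(r,0) as t ↓ 0 for every r ≥ 0; without it (a)–(c) do not link φ(·,0) to φ(·,t), and the claim fails, e.g. n=1, K=1/r², u=(2/π)arctan(x/(πt+b)), φ=(2/π)arctan(r/(πt+a)) for t>0, a>b, φ(r,0)=(2/π)arctan(r/b). *)

theory Defs
  imports "HOL-Analysis.Analysis"
begin

definition trunc_LK ::
  "('a::euclidean_space \<Rightarrow> real) \<Rightarrow> ('a \<Rightarrow> real) \<Rightarrow> 'a \<Rightarrow> real \<Rightarrow> real" where
  "trunc_LK K f x \<delta> = (LINT r:{r. norm r > \<delta>}|lborel. K r * (f (x + r) - f x))"

text \<open>Existence of the principal value includes integrability of the truncated integrands, since
  the Bochner integral of a non-integrable function is 0 by convention. With domain type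
  \<^typ>\<open>real\<close> these definitions give the one-dimensional principal value. The value
  of \<open>K\<close> at the origin is never used.\<close>

definition LK_exists ::
  "('a::euclidean_space \<Rightarrow> real) \<Rightarrow> ('a \<Rightarrow> real) \<Rightarrow> 'a \<Rightarrow> bool" where
  "LK_exists K f x \<longleftrightarrow>
     (\<forall>\<delta>>0. set_integrable lborel {r. norm r > \<delta>} (\<lambda>r. K r * (f (x + r) - f x))) \<and>
     (\<exists>l. (trunc_LK K f x \<longlongrightarrow> l) (at_right 0))"

definition LK ::
  "('a::euclidean_space \<Rightarrow> real) \<Rightarrow> ('a \<Rightarrow> real) \<Rightarrow> 'a \<Rightarrow> real" where
  "LK K f x = Lim (at_right 0) (trunc_LK K f x)"

text \<open>The point \<open>(w, p)\<close>, where \<open>w\<close> is the coordinate with index \<open>k\<close> and \<open>p\<close> lists the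
  remaining \<open>n - 1\<close> coordinates. Lebesgue measure on the space of these \<open>p\<close> is the product measure
  over the index set \<^term>\<open>- {k}\<close>; for \<open>n = 1\<close> this is the unit point mass, so that
  \<open>K_tilde k K w\<close> is then just the value of \<open>K\<close> at \<open>w\<close>.\<close>

definition join_coord :: "'n::finite \<Rightarrow> real \<Rightarrow> ('n \<Rightarrow> real) \<Rightarrow> real ^ 'n" where
  "join_coord k w p = (\<chi> i. if i = k then w else p i)"

definition K_tilde :: "'n::finite \<Rightarrow> (real ^ 'n \<Rightarrow> real) \<Rightarrow> real \<Rightarrow> real" where
  "K_tilde k K w = (LINT p|Pi\<^sub>M (- {k}) (\<lambda>_. lborel). K (join_coord k w p))"

definition is_modulus :: "(real \<Rightarrow> real) \<Rightarrow> ('a::real_normed_vector \<Rightarrow> real) \<Rightarrow> bool" where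
  "is_modulus \<omega> f \<longleftrightarrow>
     (\<forall>r\<ge>0. \<omega> r \<ge> 0) \<and> continuous (at 0 within {0..}) \<omega> \<and> \<omega> 0 = 0 \<and>
     (\<forall>x y. \<bar>f y - f x\<bar> \<le> 2 * \<omega> (norm (y - x) / 2))"

definition C1_halfline :: "(real \<Rightarrow> real) \<Rightarrow> bool" where
  "C1_halfline f \<longleftrightarrow>
     (\<exists>f'. (\<forall>r\<ge>0. (f has_real_derivative f' r) (at r within {0..})) \<and> continuous_on {0..} f')"

definition C11_loc :: "('a::euclidean_space \<Rightarrow> real) \<Rightarrow> bool" where
  "C11_loc f \<longleftrightarrow>
     (\<exists>g. (\<forall>x. GDERIV f x :> g x) \<and> (\<forall>C. compact C \<longrightarrow> (\<exists>L. L-lipschitz_on C g)))"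

primrec C_k :: "nat \<Rightarrow> ('a::euclidean_space \<Rightarrow> real) \<Rightarrow> bool" where
  "C_k 0 f \<longleftrightarrow> continuous_on UNIV f"
| "C_k (Suc m) f \<longleftrightarrow> (\<forall>x. f differentiable (at x)) \<and>
     (\<forall>b\<in>Basis. C_k m (\<lambda>x. frechet_derivative f (at x) b))"

definition C_infinity :: "('a::euclidean_space \<Rightarrow> real) \<Rightarrow> bool" where
  "C_infinity f \<longleftrightarrow> (\<forall>m. C_k m f)"

definition odd_ext :: "(real \<Rightarrow> real) \<Rightarrow> real \<Rightarrow> real" where
  "odd_ext f r = (if r \<ge> 0 then f r else - f (- r))"

end

theory Submission
  imports Defs
begin

text \<open>The proof is a maximum principle in doubled variables, where the two points are coupled by
  reflection. If the estimate fails at some time \<open>T\<close>, consider on \<open>[0, T]\<close> the function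
  \<open>\<Phi>(x, y, t) = u(y, t) - u(x, t) - 2 \<phi>(|x - y|/2, t) - \<epsilon> (\<Psi>(x) + \<Psi>(y)) - \<eta> t\<close>.
  For small \<open>\<epsilon>\<close> and \<open>\<eta>\<close> it is positive somewhere. Since \<open>u\<close> is bounded and \<open>\<Psi>\<close> tends to infinity, it attains its
  maximum (\<open>coercive_attains_maximum\<close>; the continuity of \<open>\<phi>\<close> in both variables comes from
  \<open>continuous_on_Times_of_mono_slices\<close>). The maximum does not lie on the diagonal, where the differences
  vanish, nor at \<open>t = 0\<close>, where \<open>\<phi>\<close> is a modulus; so the time derivative of \<open>\<Phi>\<close> at the maximum is nonnegative.

  On the other hand that derivative equals
  \<open>L u(y) - L u(x) - 2 L\<^sub>1 f(s) - \<eta>\<close>, where \<open>L\<close> and \<open>L\<^sub>1\<close> are the operators with kernels \<open>K\<close> and \<open>K_tilde\<close>,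
  \<open>f\<close> is the odd extension of \<open>\<phi>\<close> at that time, and \<open>s = |x - y|/2\<close>. The
  central estimate \<open>generator_comparison_at_maximum\<close> bounds it by
  \<open>\<epsilon> (L \<Psi>(x) + L \<Psi>(y)) - \<eta> \<le> 2 \<epsilon> K\<^sub>0 - \<eta>\<close>, which is negative once \<open>\<epsilon>\<close> is small compared with \<open>\<eta>\<close>: a contradiction.

  The central estimate lets a jump \<open>r\<close> of \<open>y\<close> be accompanied by the mirrored jump of \<open>x\<close>, so that the two points remain
  mirror images in their bisecting hyperplane \<open>H\<close>. As long as \<open>y\<close> stays on its side of \<open>H\<close>, the maximum property controls
  the jump. A jump across \<open>H\<close> exchanges the roles of the two points and may be bad, but it is paired with the jump
  to the reflected endpoint, which is shorter and hence, as \<open>K\<close> is non-increasing, at least as likely; the pair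
  together is harmless (\<open>reflected_integral_nonpos\<close>). Oddness of \<open>f\<close> is what makes the two contributions cancel.

  Only the component of \<open>r\<close> along \<open>y - x\<close> changes the distance, so the term with \<open>f\<close> is the \<open>n\<close>-dimensional operator
  applied to a function of one coordinate. Integrating out the other coordinates gives the kernel \<open>K_tilde\<close>; that
  the two ways of truncating the principal value agree in the limit is \<open>ridge_principal_value_tendsto\<close>.\<close>

section \<open>Lebesgue measure under isometries and coordinate splitting\<close>

lemma nn_integral_lborel_translate:
  fixes c :: "'a::euclidean_space"
  assumes [measurable]: "g \<in> borel_measurable borel"
  shows "(\<integral>\<^sup>+x. g (c + x) \<partial>lborel) = (\<integral>\<^sup>+x. g x \<partial>lborel)"
  by (subst (2) lborel_distr_plus[of c, symmetric]) (simp add: nn_integral_distr)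

text \<open>The image measure of Lebesgue measure under an orthogonal \<open>T\<close> is again translation invariant.
  Integrating \<open>indicator A (T x + y) * indicator B y\<close> in the two possible orders, where \<open>B\<close> is the
  unit ball, therefore compares it with Lebesgue measure: translation invariance in \<open>x\<close> extracts the
  image measure of \<open>A\<close>, while translation invariance in \<open>y\<close>, together with the fact that \<open>T\<close> preserves
  balls, extracts the Lebesgue measure of \<open>A\<close>. The common factor is the volume of \<open>B\<close>, which is
  positive and finite.\<close>

lemma lborel_distr_orthogonal:
  fixes T :: "'a::euclidean_space \<Rightarrow> 'a"
  assumes T: "orthogonal_transformation T"
  shows "distr lborel borel T = lborel"
proof (rule measure_eqI)
  show "sets (distr lborel borel T) = sets lborel" by simp
next
  fix A assume "A \<in> sets (distr lborel borel T)"
  then have [measurable]: "A \<in> sets borel" by simp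
  define S where "S = inv T"
  have lin: "linear T" using T by (rule orthogonal_transformation_linear)
  have S: "orthogonal_transformation S"
    unfolding S_def using T by (rule orthogonal_transformation_inv)
  have TS: "T (S y) = y" for y
    unfolding S_def by (metis T bij_inv_eq_iff orthogonal_transformation_bij)
  have ST: "S (T y) = y" for y
    unfolding S_def by (metis T bij_inv_eq_iff orthogonal_transformation_bij)
  have [measurable]: "T \<in> borel_measurable borel"
    by (intro borel_measurable_continuous_onI linear_continuous_on linear_conv_bounded_linear[THEN iffD1] lin)
  define B where "B = ball (0::'a) 1"
  have [measurable]: "B \<in> sets borel" by (simp add: B_def)
  define v where "v = emeasure lborel B"
  define a where "a = emeasure (distr lborel borel T) A"
  have a: "a = (\<integral>\<^sup>+x. indicator A (T x) \<partial>lborel)"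
    unfolding a_def by (simp add: nn_integral_distr flip: nn_integral_indicator)
  have "(\<integral>\<^sup>+y. \<integral>\<^sup>+x. indicator A (T x + y) * indicator B y \<partial>lborel \<partial>lborel)
      = (\<integral>\<^sup>+y. a * indicator B y \<partial>lborel)"
  proof (rule nn_integral_cong)
    fix y :: 'a
    have "(\<integral>\<^sup>+x. indicator A (T x + y) \<partial>lborel) = (\<integral>\<^sup>+x. indicator A (T (S y + x)) \<partial>lborel)"
      by (simp add: linear_add[OF lin] TS add.commute)
    also have "\<dots> = a"
      unfolding a by (rule nn_integral_lborel_translate[of "\<lambda>x. indicator A (T x)"]) simp
    finally show "(\<integral>\<^sup>+x. indicator A (T x + y) * indicator B y \<partial>lborel) = a * indicator B y"
      by (simp add: nn_integral_multc)
  qed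
  also have "\<dots> = a * v"
    by (simp add: nn_integral_cmult_indicator v_def)
  finally have 1: "(\<integral>\<^sup>+y. \<integral>\<^sup>+x. indicator A (T x + y) * indicator B y \<partial>lborel \<partial>lborel) = a * v" .
  have "(\<integral>\<^sup>+y. \<integral>\<^sup>+x. indicator A (T x + y) * indicator B y \<partial>lborel \<partial>lborel)
      = (\<integral>\<^sup>+x. \<integral>\<^sup>+y. indicator A (T x + y) * indicator B y \<partial>lborel \<partial>lborel)"
    by (rule lborel_pair.Fubini') simp
  also have "\<dots> = (\<integral>\<^sup>+x. \<integral>\<^sup>+z. indicator A z * indicator B (z - T x) \<partial>lborel \<partial>lborel)"
  proof (rule nn_integral_cong)
    fix x :: 'a
    show "(\<integral>\<^sup>+y. indicator A (T x + y) * indicator B y \<partial>lborel)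
       = (\<integral>\<^sup>+z. indicator A z * indicator B (z - T x) \<partial>lborel)"
      using nn_integral_lborel_translate[of "\<lambda>z. indicator A z * indicator B (z - T x)" "T x"]
      by simp
  qed
  also have "\<dots> = (\<integral>\<^sup>+z. \<integral>\<^sup>+x. indicator A z * indicator B (z - T x) \<partial>lborel \<partial>lborel)"
    by (rule lborel_pair.Fubini') simp
  also have "\<dots> = (\<integral>\<^sup>+z. v * indicator A z \<partial>lborel)"
  proof (rule nn_integral_cong)
    fix z :: 'a
    have "norm (z - T x) = norm (- S z + x)" for x
    proof -
      have "z - T x = T (S z - x)" by (simp add: linear_diff[OF lin] TS)
      then have "norm (z - T x) = norm (S z - x)"
        using T by (simp add: orthogonal_transformation_norm)
      then show ?thesis by (simp add: norm_minus_commute)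
    qed
    then have "(\<integral>\<^sup>+x. indicator B (z - T x) \<partial>lborel) = (\<integral>\<^sup>+x. indicator B (- S z + x) \<partial>lborel)"
      by (intro nn_integral_cong) (auto simp: B_def indicator_def)
    also have "\<dots> = v"
      unfolding v_def
      by (subst nn_integral_lborel_translate[of "indicator B"]) simp_all
    finally show "(\<integral>\<^sup>+x. indicator A z * indicator B (z - T x) \<partial>lborel) = v * indicator A z"
      by (simp add: nn_integral_cmult mult.commute)
  qed
  also have "\<dots> = v * emeasure lborel A"
    by (simp add: nn_integral_cmult_indicator)
  finally have "a * v = emeasure lborel A * v"
    using 1 by (simp add: mult.commute)
  moreover have "v \<noteq> 0"
    using content_ball_pos[of 1 "0::'a"] by (auto simp: v_def B_def measure_def)
  moreover have "v \<noteq> \<infinity>"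
    unfolding v_def B_def using emeasure_bounded_finite[OF bounded_ball, of "0::'a" 1] by simp
  ultimately show "emeasure (distr lborel borel T) A = emeasure lborel A"
    unfolding a_def[symmetric] by (metis mult_divide_eq_ennreal infinity_ennreal_def)
qed

lemma
  fixes T :: "'a::euclidean_space \<Rightarrow> 'a" and g :: "'a \<Rightarrow> real"
  assumes T: "orthogonal_transformation T" and [measurable]: "g \<in> borel_measurable borel"
  shows integral_lborel_orthogonal_affine:
      "(LINT x|lborel. g (T x + c)) = (LINT x|lborel. g x)"
    and integrable_lborel_orthogonal_affine:
      "integrable lborel (\<lambda>x. g (T x + c)) \<longleftrightarrow> integrable lborel g"
proof -
  have [measurable]: "T \<in> borel_measurable borel"
    by (intro borel_measurable_continuous_onI linear_continuous_on linear_conv_bounded_linear[THEN iffD1]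
        orthogonal_transformation_linear T)
  have "distr (distr lborel borel T) borel ((+) c) = (lborel :: 'a measure)"
    by (simp add: lborel_distr_orthogonal[OF T] lborel_distr_plus)
  then have eq: "distr lborel borel (\<lambda>x. T x + c) = (lborel :: 'a measure)"
    by (simp add: distr_distr o_def add.commute)
  show "(LINT x|lborel. g (T x + c)) = (LINT x|lborel. g x)"
    by (subst (2) eq[symmetric]) (simp add: integral_distr)
  show "integrable lborel (\<lambda>x. g (T x + c)) \<longleftrightarrow> integrable lborel g"
    by (subst (2) eq[symmetric]) (simp add: integrable_distr_eq)
qed

lemma measurable_join_coord:
  fixes k :: "'n::finite"
  shows
  "(\<lambda>(w, p). join_coord k w p) \<in> borel_measurable (lborel \<Otimes>\<^sub>M Pi\<^sub>M (- {k}) (\<lambda>_. lborel))"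
    (is "?j \<in> borel_measurable ?M")
proof (subst borel_measurable_euclidean_space, rule ballI)
  fix b :: "real ^ 'n" assume "b \<in> Basis"
  then obtain i where b: "b = axis i 1" by (auto simp: Basis_vec_def)
  show "(\<lambda>z. ?j z \<bullet> b) \<in> borel_measurable ?M"
    unfolding b by (cases "i = k")
      (simp_all add: inner_axis join_coord_def split_beta measurable_compose[OF measurable_snd measurable_component_singleton])
qed

text \<open>Both sides agree on boxes. Through this product decomposition, Fubini's theorem produces
  \<^const>\<open>K_tilde\<close> as the inner integral.\<close>

lemma lborel_eq_distr_join_coord:
  "distr (lborel \<Otimes>\<^sub>M Pi\<^sub>M (- {k}) (\<lambda>_. lborel)) borel (\<lambda>(w, p). join_coord k w p)
     = (lborel :: (real ^ 'n::finite) measure)"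
proof -
  interpret P: product_sigma_finite "\<lambda>_::'n. lborel :: real measure" ..
  interpret P': finite_product_sigma_finite "\<lambda>_::'n. lborel :: real measure" "- {k}" 
    by standard simp
  interpret PP: pair_sigma_finite "lborel :: real measure" "Pi\<^sub>M (- {k}) (\<lambda>_. lborel :: real measure)" ..
  let ?M = "lborel \<Otimes>\<^sub>M Pi\<^sub>M (- {k}) (\<lambda>_. lborel :: real measure)"
  note measurable_join_coord [measurable]
  show ?thesis
  proof (rule lborel_eqI[symmetric])
    fix l u :: "real ^ 'n"
    assume lu: "\<And>b. b \<in> Basis \<Longrightarrow> l \<bullet> b \<le> u \<bullet> b"
    have lu': "l $ i \<le> u $ i" for i
      using lu[of "axis i 1"] by (simp add: inner_axis)
    have eq: "(\<lambda>(w, p). join_coord k w p) -` box l u \<inter> space ?M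
       = {l $ k <..< u $ k} \<times> (\<Pi>\<^sub>E i\<in>- {k}. {l $ i <..< u $ i})"
    proof (intro set_eqI iffI)
      fix z assume "z \<in> (\<lambda>(w, p). join_coord k w p) -` box l u \<inter> space ?M"
      then have z: "join_coord k (fst z) (snd z) \<in> box l u" "z \<in> space ?M"
        by (auto simp: split_beta)
      have "l $ i < (if i = k then fst z else snd z i) \<and> (if i = k then fst z else snd z i) < u $ i" for i
        using z(1) by (simp add: mem_box_cart join_coord_def)
      note z' = this
      have "fst z \<in> {l $ k <..< u $ k}" using z'[of k] by simp
      moreover have "snd z \<in> (\<Pi>\<^sub>E i\<in>- {k}. {l $ i <..< u $ i})"
      proof (rule PiE_I)
        fix i assume "i \<in> - {k}"
        then show "snd z i \<in> {l $ i <..< u $ i}" using z'[of i] by simp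
      next
        fix i assume "i \<notin> - {k}"
        then show "snd z i = undefined"
          using z(2) by (cases z) (auto simp: space_pair_measure space_PiM PiE_iff extensional_def)
      qed
      ultimately show "z \<in> {l $ k <..< u $ k} \<times> (\<Pi>\<^sub>E i\<in>- {k}. {l $ i <..< u $ i})"
        by (simp add: mem_Times_iff)
    next
      fix z assume "z \<in> {l $ k <..< u $ k} \<times> (\<Pi>\<^sub>E i\<in>- {k}. {l $ i <..< u $ i})"
      then obtain w p where z: "z = (w, p)" "w \<in> {l $ k <..< u $ k}"
          "p \<in> (\<Pi>\<^sub>E i\<in>- {k}. {l $ i <..< u $ i})"
        by (cases z) simp
      have "p i \<in> {l $ i <..< u $ i}" if "i \<noteq> k" for i
        using PiE_mem[OF z(3), of i] that by simp
      then have "join_coord k w p \<in> box l u"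
        using z(2) by (simp add: mem_box_cart join_coord_def)
      moreover have "p \<in> extensional (- {k})" using z(3) by (simp add: PiE_iff)
      ultimately show "z \<in> (\<lambda>(w, p). join_coord k w p) -` box l u \<inter> space ?M"
        by (simp add: z(1) space_pair_measure space_PiM PiE_iff)
    qed
    have "emeasure (distr ?M borel (\<lambda>(w, p). join_coord k w p)) (box l u)
       = emeasure lborel {l $ k <..< u $ k} * emeasure (Pi\<^sub>M (- {k}) (\<lambda>_. lborel)) (\<Pi>\<^sub>E i\<in>- {k}. {l $ i <..< u $ i})"
      by (simp add: emeasure_distr eq P'.emeasure_pair_measure_Times sets_PiM_I_finite)
    also have "\<dots> = ennreal (u $ k - l $ k) * (\<Prod>i\<in>-{k}. ennreal (u $ i - l $ i))"
      by (simp add: P.emeasure_PiM lu')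
    also have "\<dots> = (\<Prod>i\<in>UNIV. ennreal (u $ i - l $ i))"
      by (subst (2) prod.remove[of _ k]) (auto simp: Compl_eq_Diff_UNIV)
    also have "\<dots> = ennreal (\<Prod>i\<in>UNIV. u $ i - l $ i)"
      by (rule prod_ennreal) (simp add: lu')
    also have "(\<Prod>i\<in>UNIV. u $ i - l $ i) = (\<Prod>b\<in>Basis. (u - l) \<bullet> b)"
      by (subst prod.reindex_bij_betw[of "\<lambda>i. axis i 1" UNIV, symmetric])
        (auto simp: bij_betw_def inj_on_def axis_eq_axis Basis_vec_def inner_axis)
    finally show "emeasure (distr ?M borel (\<lambda>(w, p). join_coord k w p)) (box l u)
       = ennreal (\<Prod>b\<in>Basis. (u - l) \<bullet> b)" .
  qed simp
qed

section \<open>Truncated principal values\<close>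

definition trunc_kernel :: "('a::euclidean_space \<Rightarrow> real) \<Rightarrow> real \<Rightarrow> 'a \<Rightarrow> real" where
  "trunc_kernel K \<delta> r = (if norm r > \<delta> then K r else 0)"

lemma trunc_LK_eq:
  "trunc_LK K f x \<delta> = (LINT r|lborel. trunc_kernel K \<delta> r * (f (x + r) - f x))"
  unfolding trunc_LK_def set_lebesgue_integral_def trunc_kernel_def
  by (rule Bochner_Integration.integral_cong) (auto simp: indicator_def)

lemma LK_exists_integrable:
  assumes "LK_exists K f x" "\<delta> > 0"
  shows "integrable lborel (\<lambda>r. trunc_kernel K \<delta> r * (f (x + r) - f x))"
proof -
  have "integrable lborel (\<lambda>r. indicator {r. norm r > \<delta>} r *\<^sub>R (K r * (f (x + r) - f x)))"
    using assms unfolding LK_exists_def set_integrable_def by blast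
  then show ?thesis
    by (rule Bochner_Integration.integrable_cong[THEN iffD1, rotated -1])
      (auto simp: trunc_kernel_def indicator_def)
qed

lemma LK_exists_tendsto:
  assumes "LK_exists K f x"
  shows "((\<lambda>\<delta>. LINT r|lborel. trunc_kernel K \<delta> r * (f (x + r) - f x)) \<longlongrightarrow> LK K f x) (at_right 0)"
proof -
  obtain l where "(trunc_LK K f x \<longlongrightarrow> l) (at_right 0)"
    using assms unfolding LK_exists_def by blast
  then have "(trunc_LK K f x \<longlongrightarrow> LK K f x) (at_right 0)"
    unfolding LK_def by (metis tendsto_Lim trivial_limit_at_right_real)
  then show ?thesis by (simp add: trunc_LK_eq[abs_def])
qed

section \<open>Radial non-increasing kernels\<close>

locale radial_decreasing_kernel =
  fixes K :: "'a::euclidean_space \<Rightarrow> real"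
  assumes nonneg: "r \<noteq> 0 \<Longrightarrow> K r \<ge> 0"
    and borel: "set_borel_measurable borel (- {0}) K"
    and decreasing: "r \<noteq> 0 \<Longrightarrow> s \<noteq> 0 \<Longrightarrow> norm r \<le> norm s \<Longrightarrow> K s \<le> K r"
    and finite_moment: "(\<integral>\<^sup>+r\<in>- {0}. ennreal (min 1 ((norm r)\<^sup>2) * K r) \<partial>lborel) < \<infinity>"
begin

lemma trunc_kernel_nonneg: "\<delta> \<ge> 0 \<Longrightarrow> trunc_kernel K \<delta> r \<ge> 0"
  unfolding trunc_kernel_def using nonneg[of r] by fastforce

lemma trunc_kernel_antimono:
  assumes "\<delta> \<ge> 0" "norm r > \<delta>" "norm r \<le> norm s"
  shows "trunc_kernel K \<delta> s \<le> trunc_kernel K \<delta> r"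
  unfolding trunc_kernel_def using assms decreasing[of r s] by fastforce

text \<open>Points of equal norm bound each other's kernel values, so monotonicity in the norm contains
  radial symmetry.\<close>

lemma trunc_kernel_radial:
  assumes "\<delta> \<ge> 0" "norm r = norm s"
  shows "trunc_kernel K \<delta> r = trunc_kernel K \<delta> s"
  using trunc_kernel_antimono[of \<delta> r s] trunc_kernel_antimono[of \<delta> s r] assms
  by (cases "norm r > \<delta>") (auto simp: trunc_kernel_def)

lemma trunc_kernel_measurable [measurable]:
  assumes "\<delta> \<ge> 0"
  shows "trunc_kernel K \<delta> \<in> borel_measurable borel"
proof -
  have [measurable]: "(\<lambda>r. indicator (- {0}) r *\<^sub>R K r) \<in> borel_measurable borel"
    using borel unfolding set_borel_measurable_def .
  have "trunc_kernel K \<delta> = (\<lambda>r. if norm r > \<delta> then indicator (- {0}) r *\<^sub>R K r else 0)"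
    using assms by (auto simp: trunc_kernel_def fun_eq_iff indicator_def)
  then show ?thesis by simp
qed

text \<open>The integrand of the moment condition, with the value of \<open>K\<close> at the origin replaced by 0. It is the
  dominating function in all convergence arguments below.\<close>

definition moment_density :: "'a \<Rightarrow> real" where
  "moment_density r = min 1 ((norm r)\<^sup>2) * (indicator (- {0}) r *\<^sub>R K r)"

lemma moment_density_nonneg: "moment_density r \<ge> 0"
  using nonneg[of r] by (cases "r = 0") (auto simp: moment_density_def)

lemma integrable_moment_density: "integrable lborel moment_density"
proof (rule integrableI_nonneg)
  have [measurable]: "(\<lambda>r. indicator (- {0}) r *\<^sub>R K r) \<in> borel_measurable borel"
    using borel unfolding set_borel_measurable_def .
  show "moment_density \<in> borel_measurable lborel"
    unfolding moment_density_def by measurable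
  show "AE r in lborel. 0 \<le> moment_density r" by (simp add: moment_density_nonneg)
  have "(\<integral>\<^sup>+r. ennreal (moment_density r) \<partial>lborel)
     = (\<integral>\<^sup>+r\<in>- {0}. ennreal (min 1 ((norm r)\<^sup>2) * K r) \<partial>lborel)"
    by (rule nn_integral_cong) (auto simp: moment_density_def indicator_def)
  then show "(\<integral>\<^sup>+r. ennreal (moment_density r) \<partial>lborel) < \<infinity>"
    using finite_moment by simp
qed

text \<open>Away from the origin the weight \<open>min 1 |r|\<^sup>2\<close> is bounded below, so a truncated kernel is integrable
  against every bounded measurable function.\<close>

lemma integrable_trunc_kernel_mult:
  assumes \<delta>: "\<delta> > 0" and g[measurable]: "g \<in> borel_measurable borel" and B: "\<And>r. \<bar>g r\<bar> \<le> B"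
  shows "integrable lborel (\<lambda>r. trunc_kernel K \<delta> r * g r)"
proof (rule Bochner_Integration.integrable_bound)
  show "integrable lborel (\<lambda>r. B / min 1 (\<delta>\<^sup>2) * moment_density r)"
    by (intro integrable_mult_right integrable_moment_density)
  show "(\<lambda>r. trunc_kernel K \<delta> r * g r) \<in> borel_measurable lborel"
    using \<delta> by simp
  show "AE r in lborel. norm (trunc_kernel K \<delta> r * g r) \<le> norm (B / min 1 (\<delta>\<^sup>2) * moment_density r)"
  proof (rule AE_I2)
    fix r :: 'a
    have B0: "B \<ge> 0" using B[of 0] by linarith
    have m0: "min 1 (\<delta>\<^sup>2) > 0" using \<delta> by simp
    show "norm (trunc_kernel K \<delta> r * g r) \<le> norm (B / min 1 (\<delta>\<^sup>2) * moment_density r)"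
    proof (cases "norm r > \<delta>")
      case True
      then have r: "r \<noteq> 0" using \<delta> by auto
      have "\<delta>\<^sup>2 \<le> (norm r)\<^sup>2" using True \<delta> by (intro power_mono) auto
      then have "min 1 (\<delta>\<^sup>2) \<le> min 1 ((norm r)\<^sup>2)" by auto
      then have 1: "1 \<le> min 1 ((norm r)\<^sup>2) / min 1 (\<delta>\<^sup>2)" using m0 by simp
      have "\<bar>K r * g r\<bar> = K r * \<bar>g r\<bar>" using nonneg[OF r] by (simp add: abs_mult)
      also have "\<dots> \<le> K r * B" using nonneg[OF r] B by (intro mult_left_mono) auto
      also have "\<dots> \<le> (K r * B) * (min 1 ((norm r)\<^sup>2) / min 1 (\<delta>\<^sup>2))"
        using mult_left_mono[OF 1, of "K r * B"] nonneg[OF r] B0 by simp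
      also have "\<dots> = B / min 1 (\<delta>\<^sup>2) * moment_density r"
        using r by (simp add: moment_density_def)
      finally have "\<bar>K r * g r\<bar> \<le> \<bar>B / min 1 (\<delta>\<^sup>2) * moment_density r\<bar>" by linarith
      then show ?thesis using True unfolding trunc_kernel_def real_norm_def by simp
    qed (simp add: trunc_kernel_def)
  qed
qed

end

section \<open>Reflection coupling\<close>

definition mirror :: "'a::real_inner \<Rightarrow> 'a \<Rightarrow> 'a" where
  "mirror e r = r - (2 * (r \<bullet> e)) *\<^sub>R e"

context
  fixes e :: "'a::real_inner"
  assumes e: "norm e = 1"
begin

lemma unit_inner_self: "e \<bullet> e = 1"
  using e by (simp add: norm_eq_1)

lemma mirror_inner: "mirror e r \<bullet> e = - (r \<bullet> e)"
  by (simp add: mirror_def inner_diff_left unit_inner_self)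

lemma mirror_mirror: "mirror e (mirror e r) = r"
  unfolding mirror_def[of e "mirror e r"] mirror_inner by (simp add: mirror_def)

lemma linear_mirror: "linear (mirror e)"
  by (rule linearI) (simp_all add: mirror_def algebra_simps)

lemma orthogonal_transformation_mirror: "orthogonal_transformation (mirror e)"
  unfolding orthogonal_transformation_def
proof (intro conjI allI linear_mirror)
  show "mirror e v \<bullet> mirror e w = v \<bullet> w" for v w
    using inner_commute[of e w]
    by (simp add: mirror_def inner_diff_left inner_diff_right unit_inner_self)
qed

text \<open>The map \<open>r \<mapsto> mirror e r - 2 s e\<close> is the reflection in the hyperplane \<open>r \<bullet> e = - s\<close>. For \<open>s \<ge> 0\<close> it moves the
  points of the half space \<open>r \<bullet> e \<ge> - s\<close> away from the origin.\<close>

lemma norm_mirror_shift: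
  "(norm (mirror e r - (2 * s) *\<^sub>R e))\<^sup>2 = (norm r)\<^sup>2 + 4 * s * (r \<bullet> e + s)"
proof -
  have "mirror e r \<bullet> mirror e r = r \<bullet> r"
    using orthogonal_transformation_mirror by (simp add: orthogonal_transformation_def)
  moreover have "e \<bullet> mirror e r = - (r \<bullet> e)"
    by (metis inner_commute mirror_inner)
  ultimately show ?thesis
    by (simp add: power2_norm_eq_inner inner_diff_left inner_diff_right mirror_inner unit_inner_self
        algebra_simps)
qed

end

text \<open>This is where the monotonicity of the kernel enters. Average the integral with its image under the
  reflection \<open>\<tau>\<close> in the hyperplane \<open>r \<bullet> e = - s\<close>, and consider \<open>r\<close> in the half space that contains the origin.
  The kernel has a weight \<open>a\<close> at \<open>r\<close> and a weight \<open>b \<le> a\<close> at \<open>\<tau> r\<close>, since \<open>\<tau> r\<close> is farther from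
  the origin. Hence \<open>a F(r) + b F(\<tau> r) = (a - b) F(r) + b (F(r) + F(\<tau> r)) \<le> 0\<close>. Truncation breaks
  \<open>b \<le> a\<close> only when \<open>r\<close> lies in the ball of radius \<open>\<delta>\<close>, where \<open>a = 0\<close>; the sign of \<open>F(\<tau> r)\<close> there is a
  separate assumption.\<close>

lemma (in radial_decreasing_kernel) reflected_integral_nonpos:
  fixes e :: 'a and s \<delta> :: real and F :: "'a \<Rightarrow> real"
  defines "\<tau> \<equiv> \<lambda>r. mirror e r - (2 * s) *\<^sub>R e"
  assumes e: "norm e = 1" and s: "s > 0" and \<delta>: "\<delta> \<ge> 0"
    and int: "integrable lborel (\<lambda>r. trunc_kernel K \<delta> r * F r)"
    and half: "\<And>r. r \<bullet> e \<ge> - s \<Longrightarrow> F r \<le> 0"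
    and pair: "\<And>r. F r + F (\<tau> r) \<le> 0"
    and near: "\<And>r. norm r \<le> \<delta> \<Longrightarrow> F (\<tau> r) \<le> 0"
  shows "(LINT r|lborel. trunc_kernel K \<delta> r * F r) \<le> 0"
proof -
  define G where "G r = trunc_kernel K \<delta> r * F r" for r
  have \<tau>_inner: "\<tau> r \<bullet> e = - (r \<bullet> e) - 2 * s" for r
    by (simp add: \<tau>_def inner_diff_left mirror_inner[OF e] unit_inner_self[OF e])
  have "mirror e e = - e"
    using scaleR_2[of e] by (simp add: mirror_def unit_inner_self[OF e])
  then have \<tau>\<tau>: "\<tau> (\<tau> r) = r" for r
    by (simp add: \<tau>_def linear_diff[OF linear_mirror[OF e]] linear_scale[OF linear_mirror[OF e]]
        mirror_mirror[OF e])
  have upper: "G r + G (\<tau> r) \<le> 0" if r: "r \<bullet> e \<ge> - s" for r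
  proof (cases "norm r > \<delta>")
    case True
    have "(norm r)\<^sup>2 \<le> (norm (\<tau> r))\<^sup>2"
      unfolding \<tau>_def norm_mirror_shift[OF e] using s r by simp
    then have "norm r \<le> norm (\<tau> r)" by (rule power2_le_imp_le) simp
    then have le: "trunc_kernel K \<delta> (\<tau> r) \<le> trunc_kernel K \<delta> r"
      by (rule trunc_kernel_antimono[OF \<delta> True])
    have "G r + G (\<tau> r) = (trunc_kernel K \<delta> r - trunc_kernel K \<delta> (\<tau> r)) * F r
        + trunc_kernel K \<delta> (\<tau> r) * (F r + F (\<tau> r))"
      by (simp add: G_def algebra_simps)
    also have "\<dots> \<le> 0"
      by (rule add_nonpos_nonpos; rule mult_nonneg_nonpos)
        (use le half[OF r] pair[of r] trunc_kernel_nonneg[OF \<delta>, of "\<tau> r"] in auto)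
    finally show ?thesis .
  next
    case False
    then show ?thesis
      using near[of r] trunc_kernel_nonneg[OF \<delta>, of "\<tau> r"]
      by (simp add: G_def trunc_kernel_def mult_nonneg_nonpos)
  qed
  have G: "G r + G (\<tau> r) \<le> 0" for r
  proof (cases "r \<bullet> e \<ge> - s")
    case True
    then show ?thesis by (rule upper)
  next
    case False
    then have "\<tau> r \<bullet> e \<ge> - s" unfolding \<tau>_inner using s by linarith
    from upper[OF this] show ?thesis by (simp add: \<tau>\<tau> add.commute)
  qed
  have [measurable]: "G \<in> borel_measurable borel"
    using borel_measurable_integrable[OF int] by (simp add: G_def[abs_def])
  have intG: "integrable lborel G" using int by (simp add: G_def[abs_def])
  have \<tau>: "\<tau> = (\<lambda>r. mirror e r + - ((2 * s) *\<^sub>R e))" by (simp add: \<tau>_def fun_eq_iff)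
  note orth = orthogonal_transformation_mirror[OF e]
  have intG\<tau>: "integrable lborel (\<lambda>r. G (\<tau> r))"
    unfolding \<tau> by (subst integrable_lborel_orthogonal_affine[OF orth]) (use intG in simp_all)
  have "(LINT r|lborel. G (\<tau> r)) = (LINT r|lborel. G r)"
    unfolding \<tau> by (rule integral_lborel_orthogonal_affine[OF orth]) simp
  then have "2 * (LINT r|lborel. G r) = (LINT r|lborel. G r + G (\<tau> r))"
    by (simp add: Bochner_Integration.integral_add[OF intG intG\<tau>])
  also have "\<dots> \<le> 0"
    using integral_mono[OF Bochner_Integration.integrable_add[OF intG intG\<tau>], of "\<lambda>_. 0"] G by simp
  finally show ?thesis by (simp add: G_def)
qed

section \<open>Principal values of ridge functions\<close>

text \<open>The symmetric second difference vanishes to second order because its derivative in \<open>w\<close> is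
  \<open>g (s + w) - g (s - w)\<close>, where \<open>g\<close> is the locally Lipschitz derivative of \<open>f\<close>.\<close>

lemma C11_loc_second_difference:
  fixes f :: "real \<Rightarrow> real"
  assumes "C11_loc f"
  shows "\<exists>C. \<forall>w. \<bar>w\<bar> \<le> 1 \<longrightarrow> \<bar>f (s + w) + f (s - w) - 2 * f s\<bar> \<le> C * w\<^sup>2"
proof -
  from assms obtain g where g: "\<And>x. GDERIV f x :> g x"
    and "\<forall>C. compact C \<longrightarrow> (\<exists>L. L-lipschitz_on C g)"
    unfolding C11_loc_def by blast
  then obtain L where L: "L-lipschitz_on {s - 1..s + 1} g" by (metis compact_Icc)
  have g': "(f has_real_derivative g x) (at x)" for x
    using g[of x] unfolding gderiv_def has_field_derivative_def
    by (rule has_derivative_eq_rhs) (simp add: fun_eq_iff)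
  have L0: "L \<ge> 0" using L by (rule lipschitz_on_nonneg)
  have pos: "\<bar>f (s + w) + f (s - w) - 2 * f s\<bar> \<le> (2 * L) * w\<^sup>2" if w: "0 < w" "w \<le> 1" for w
  proof -
    define h where "h w = f (s + w) + f (s - w)" for w
    have h': "(h has_real_derivative (g (s + z) - g (s - z))) (at z)" for z
    proof -
      have "((\<lambda>w. f (s + w)) has_real_derivative g (s + z) * 1) (at z)"
        by (rule DERIV_chain2[OF g']) (auto intro!: derivative_eq_intros)
      moreover have "((\<lambda>w. f (s - w)) has_real_derivative g (s - z) * (- 1)) (at z)"
        by (rule DERIV_chain2[OF g']) (auto intro!: derivative_eq_intros)
      ultimately show ?thesis unfolding h_def by (auto dest: DERIV_add)
    qed
    obtain z where z: "0 < z" "z < w" "h w - h 0 = (w - 0) * (g (s + z) - g (s - z))"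
      using MVT2[OF w(1), of h "\<lambda>z. g (s + z) - g (s - z)"] h' by blast
    have "\<bar>g (s + z) - g (s - z)\<bar> \<le> L * (2 * z)"
      using lipschitz_onD[OF L, of "s + z" "s - z"] z w by (auto simp: dist_real_def)
    also have "\<dots> \<le> L * (2 * w)" using z L0 by (intro mult_left_mono) auto
    finally have "\<bar>h w - h 0\<bar> \<le> w * (L * (2 * w))"
      unfolding z(3) using w by (simp add: abs_mult)
    then show ?thesis by (simp add: h_def power2_eq_square algebra_simps)
  qed
  have "\<bar>f (s + w) + f (s - w) - 2 * f s\<bar> \<le> (2 * L) * w\<^sup>2" if w: "\<bar>w\<bar> \<le> 1" for w
  proof (cases "w > 0")
    case True
    then show ?thesis using pos[of w] w by simp
  next
    case False
    have "\<bar>f (s + - w) + f (s - - w) - 2 * f s\<bar> \<le> (2 * L) * (- w)\<^sup>2"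
      using pos[of "- w"] False w by (cases "w = 0") simp_all
    then show ?thesis by (simp add: add.commute[of "f (s - w)"])
  qed
  then show ?thesis by blast
qed

context
  fixes K :: "real ^ 'n::finite \<Rightarrow> real" and k :: 'n
  assumes K: "radial_decreasing_kernel K"
begin

interpretation radial_decreasing_kernel K by (rule K)

text \<open>The slab \<open>|r\<^sub>k| \<le> \<delta>\<close> shrinks to the hyperplane \<open>r\<^sub>k = 0\<close>, on which the integrand vanishes, and
  for \<open>\<delta> \<le> 1\<close> the integrand is dominated by \<open>min 1 |r|\<^sup>2 K(r)\<close>.\<close>

lemma slab_second_moment_tendsto_zero:
  "((\<lambda>\<delta>. LINT r|lborel. (if \<bar>r $ k\<bar> \<le> \<delta> then trunc_kernel K \<delta> r else 0) * (r $ k)\<^sup>2) \<longlongrightarrow> 0)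
     (at_right 0)"
proof (rule tendsto_at_right_sequentially[of 0 1])
  fix S :: "nat \<Rightarrow> real"
  assume S: "\<And>n. 0 < S n" "\<And>n. S n < 1" "S \<longlonglongrightarrow> 0"
  let ?q = "\<lambda>n r. (if \<bar>r $ k\<bar> \<le> S n then trunc_kernel K (S n) r else 0) * (r $ k)\<^sup>2"
  have [measurable]: "trunc_kernel K (S n) \<in> borel_measurable borel" for n
    using S(1)[of n] by simp
  have "(\<lambda>n. LINT r|lborel. ?q n r) \<longlonglongrightarrow> (LINT r|(lborel :: (real^'n) measure). 0)"
  proof (rule integral_dominated_convergence)
    show "integrable lborel moment_density" by (rule integrable_moment_density)
    show "?q n \<in> borel_measurable lborel" for n by measurable
    show "AE r in lborel. (\<lambda>n. ?q n r) \<longlonglongrightarrow> 0"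
    proof (rule AE_I2)
      fix r :: "real ^ 'n"
      show "(\<lambda>n. ?q n r) \<longlonglongrightarrow> 0"
      proof (cases "r $ k = 0")
        case False
        have "eventually (\<lambda>n. S n < \<bar>r $ k\<bar>) sequentially"
          using order_tendstoD(2)[OF S(3), of "\<bar>r $ k\<bar>"] False by simp
        then have "eventually (\<lambda>n. ?q n r = 0) sequentially"
          by eventually_elim simp
        then show ?thesis by (rule tendsto_eventually)
      qed simp
    qed
    show "AE r in lborel. norm (?q n r) \<le> moment_density r" for n
    proof (rule AE_I2)
      fix r :: "real ^ 'n"
      show "norm (?q n r) \<le> moment_density r"
      proof (cases "\<bar>r $ k\<bar> \<le> S n \<and> norm r > S n")
        case True
        then have r: "r \<noteq> 0" using S(1)[of n] by auto
        have "(r $ k)\<^sup>2 \<le> 1\<^sup>2"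
          using True S(2)[of n] by (subst abs_le_square_iff[symmetric]) auto
        moreover have "(r $ k)\<^sup>2 \<le> (norm r)\<^sup>2"
          using component_le_norm_cart[of r k] by (subst abs_le_square_iff[symmetric]) auto
        ultimately have "K r * (r $ k)\<^sup>2 \<le> K r * min 1 ((norm r)\<^sup>2)"
          using nonneg[OF r] by (intro mult_left_mono) auto
        then show ?thesis
          using True nonneg[OF r] r by (simp add: moment_density_def trunc_kernel_def mult.commute)
      qed (auto simp: trunc_kernel_def moment_density_nonneg)
    qed
  qed simp_all
  then show "(\<lambda>n. LINT r|lborel. ?q n r) \<longlonglongrightarrow> 0" by simp
qed simp

lemma trunc_LK_K_tilde_eq:
  fixes f :: "real \<Rightarrow> real"
  assumes [measurable]: "f \<in> borel_measurable borel" and B: "\<And>x. \<bar>f x\<bar> \<le> B" and \<delta>: "\<delta> > 0"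
  shows "trunc_LK (K_tilde k K) f s \<delta>
    = (LINT r|lborel. (if \<bar>r $ k\<bar> > \<delta> then trunc_kernel K \<delta> r else 0) * (f (s + r $ k) - f s))"
proof -
  interpret P: product_sigma_finite "\<lambda>_::'n. lborel :: real measure" ..
  interpret P': finite_product_sigma_finite "\<lambda>_::'n. lborel :: real measure" "- {k}" 
    by standard simp
  interpret PP: pair_sigma_finite "lborel :: real measure" "Pi\<^sub>M (- {k}) (\<lambda>_. lborel :: real measure)" ..
  let ?M = "lborel \<Otimes>\<^sub>M Pi\<^sub>M (- {k}) (\<lambda>_. lborel :: real measure)"
  let ?j = "\<lambda>(w, p). join_coord k w p"
  have [measurable]: "trunc_kernel K \<delta> \<in> borel_measurable borel" using \<delta> by simp
  define Q where "Q r = (if \<bar>r $ k\<bar> > \<delta> then trunc_kernel K \<delta> r else 0) * (f (s + r $ k) - f s)" for r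
  have [measurable]: "Q \<in> borel_measurable borel" unfolding Q_def by measurable
  have Q_alt: "Q r = trunc_kernel K \<delta> r * (if \<bar>r $ k\<bar> > \<delta> then f (s + r $ k) - f s else 0)" for r
    by (simp add: Q_def)
  have intQ: "integrable lborel Q"
    unfolding Q_alt
  proof (rule integrable_trunc_kernel_mult[OF \<delta>])
    fix r :: "real ^ 'n"
    show "\<bar>if \<delta> < \<bar>r $ k\<bar> then f (s + r $ k) - f s else 0\<bar> \<le> 2 * B"
      using B[of s] B[of "s + r $ k"] by auto
  qed measurable
  have [measurable]: "?j \<in> borel_measurable ?M" by (rule measurable_join_coord)
  have "integrable (distr ?M borel ?j) Q" using intQ by (simp add: lborel_eq_distr_join_coord)
  then have intQj: "integrable ?M (\<lambda>z. Q (?j z))"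
    by (subst (asm) integrable_distr_eq) simp_all
  have "(LINT r|lborel. Q r) = (LINT z|?M. Q (?j z))"
    by (subst lborel_eq_distr_join_coord[of k, symmetric]) (simp add: integral_distr)
  also have "\<dots> = (LINT w|lborel. LINT p|Pi\<^sub>M (- {k}) (\<lambda>_. lborel). Q (join_coord k w p))"
    using PP.integral_fst'[OF intQj] by simp
  also have "\<dots> = (LINT w|lborel. trunc_kernel (K_tilde k K) \<delta> w * (f (s + w) - f s))"
  proof (rule Bochner_Integration.integral_cong[OF refl])
    fix w :: real
    have comp: "join_coord k w p $ k = w" for p by (simp add: join_coord_def)
    have norm: "\<bar>w\<bar> \<le> norm (join_coord k w p)" for p
      using component_le_norm_cart[of "join_coord k w p" k] by (simp add: comp)
    show "(LINT p|Pi\<^sub>M (- {k}) (\<lambda>_. lborel). Q (join_coord k w p))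
      = trunc_kernel (K_tilde k K) \<delta> w * (f (s + w) - f s)"
    proof (cases "\<bar>w\<bar> > \<delta>")
      case True
      have "Q (join_coord k w p) = K (join_coord k w p) * (f (s + w) - f s)" for p
        using True norm[of p] by (simp add: Q_def comp trunc_kernel_def)
      then show ?thesis using True by (simp add: trunc_kernel_def K_tilde_def)
    next
      case False
      then show ?thesis by (simp add: Q_def comp trunc_kernel_def)
    qed
  qed
  finally show ?thesis unfolding trunc_LK_eq Q_def by (rule sym)
qed

text \<open>The principal value in \<open>n\<close> dimensions removes the ball \<open>|r| \<le> \<delta>\<close>, the one-dimensional one removes the
  larger slab \<open>|r\<^sub>k| \<le> \<delta>\<close>. The difference is an integral over a set symmetric under \<open>r \<mapsto> - r\<close>, so the
  increment of \<open>f\<close> can be replaced by half its symmetric second difference, which is of order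
  \<open>r\<^sub>k\<^sup>2\<close>; the second moment of the slab tends to 0.\<close>

lemma ridge_principal_value_tendsto:
  fixes f :: "real \<Rightarrow> real"
  assumes [measurable]: "f \<in> borel_measurable borel" and B: "\<And>x. \<bar>f x\<bar> \<le> B"
    and C: "\<And>w. \<bar>w\<bar> \<le> 1 \<Longrightarrow> \<bar>f (s + w) + f (s - w) - 2 * f s\<bar> \<le> C * w\<^sup>2"
    and ex: "LK_exists (K_tilde k K) f s"
  shows "((\<lambda>\<delta>. LINT r|lborel. trunc_kernel K \<delta> r * (f (s + r $ k) - f s))
     \<longlongrightarrow> LK (K_tilde k K) f s) (at_right 0)"
proof -
  let ?h = "\<lambda>r :: real ^ 'n. f (s + r $ k) - f s"
  let ?q = "\<lambda>\<delta> r. if \<bar>r $ k\<bar> \<le> \<delta> then trunc_kernel K \<delta> r else 0"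
  have slab: "((\<lambda>\<delta>. LINT r|lborel. ?q \<delta> r * ?h r) \<longlongrightarrow> 0) (at_right 0)"
  proof (rule Lim_null_comparison)
    show "((\<lambda>\<delta>. C * (LINT r|lborel. ?q \<delta> r * (r $ k)\<^sup>2)) \<longlongrightarrow> 0) (at_right 0)"
      by (rule tendsto_mult_right_zero[OF slab_second_moment_tendsto_zero])
    show "eventually (\<lambda>\<delta>. norm (LINT r|lborel. ?q \<delta> r * ?h r)
        \<le> C * (LINT r|lborel. ?q \<delta> r * (r $ k)\<^sup>2)) (at_right 0)"
      unfolding eventually_at_right_field
    proof (intro exI[of _ 1] conjI allI impI)
      fix \<delta> :: real assume \<delta>: "0 < \<delta>" "\<delta> < 1"
      have [measurable]: "trunc_kernel K \<delta> \<in> borel_measurable borel" using \<delta> by simp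
      have C0: "C \<ge> 0" using C[of 1] by simp
      have int: "integrable lborel (\<lambda>r. ?q \<delta> r * g r)"
        if [measurable]: "g \<in> borel_measurable borel" 
          and "\<And>r. \<bar>r $ k\<bar> \<le> 1 \<Longrightarrow> \<bar>g r\<bar> \<le> D" for g D
      proof -
        have D: "D \<ge> 0" using that(2)[of 0] by simp
        have "integrable lborel (\<lambda>r. trunc_kernel K \<delta> r * (if \<bar>r $ k\<bar> \<le> \<delta> then g r else 0))"
          using \<delta> that(2) D by (intro integrable_trunc_kernel_mult[where B = D]) auto
        then show ?thesis
          by (rule Bochner_Integration.integrable_cong[THEN iffD1, rotated -1]) auto
      qed
      define G where "G r = ?q \<delta> r * ?h r" for r
      have G_meas: "G \<in> borel_measurable borel" unfolding G_def by measurable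
      have intG: "integrable lborel G"
        unfolding G_def
      proof (rule int)
        show "\<bar>?h r\<bar> \<le> 2 * B" for r using B[of "s + r $ k"] B[of s] by auto
      qed measurable
      have int2: "integrable lborel (\<lambda>r. ?q \<delta> r * (r $ k)\<^sup>2)"
      proof (rule int)
        fix r :: "real ^ 'n" assume "\<bar>r $ k\<bar> \<le> 1"
        then show "\<bar>(r $ k)\<^sup>2\<bar> \<le> 1" using abs_le_square_iff[of "r $ k" 1] by simp
      qed measurable
      have neg: "orthogonal_transformation (uminus :: real ^ 'n \<Rightarrow> _)"
        by (simp add: orthogonal_transformation_neg)
      have intG': "integrable lborel (\<lambda>r. G (- r))"
        using integrable_lborel_orthogonal_affine[OF neg G_meas, of 0, unfolded add_0_right] intG
        by (rule iffD2)
      have "(LINT r|lborel. G (- r)) = (LINT r|lborel. G r)"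
        by (rule integral_lborel_orthogonal_affine[OF neg G_meas, of 0, unfolded add_0_right])
      then have "2 * (LINT r|lborel. G r) = (LINT r|lborel. G r + G (- r))"
        by (simp add: Bochner_Integration.integral_add[OF intG intG'])
      also have "norm \<dots> \<le> (LINT r|lborel. C * (?q \<delta> r * (r $ k)\<^sup>2))"
      proof (rule Bochner_Integration.integral_norm_bound_integral)
        show "integrable lborel (\<lambda>r. G r + G (- r))" using intG intG' by simp
        show "integrable lborel (\<lambda>r. C * (?q \<delta> r * (r $ k)\<^sup>2))" using int2 by simp
        fix r :: "real ^ 'n"
        have "trunc_kernel K \<delta> (- r) = trunc_kernel K \<delta> r"
          using \<delta> by (intro trunc_kernel_radial) auto
        then have eq: "G r + G (- r) = ?q \<delta> r * (f (s + r $ k) + f (s - r $ k) - 2 * f s)"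
          by (simp add: G_def algebra_simps)
        show "norm (G r + G (- r)) \<le> C * (?q \<delta> r * (r $ k)\<^sup>2)"
          unfolding eq using C[of "r $ k"] trunc_kernel_nonneg[of \<delta> r] \<delta>
          by (auto simp: abs_mult mult.left_commute[of C] intro!: mult_left_mono)
      qed
      also have "\<dots> = C * (LINT r|lborel. ?q \<delta> r * (r $ k)\<^sup>2)" by simp
      finally show "norm (LINT r|lborel. ?q \<delta> r * ?h r)
          \<le> C * (LINT r|lborel. ?q \<delta> r * (r $ k)\<^sup>2)"
        unfolding G_def by simp
    qed simp
  qed
  have "(trunc_LK (K_tilde k K) f s \<longlongrightarrow> LK (K_tilde k K) f s) (at_right 0)"
    using LK_exists_tendsto[OF ex] by (simp add: trunc_LK_eq[abs_def])
  from tendsto_add[OF this slab]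
  have "((\<lambda>\<delta>. trunc_LK (K_tilde k K) f s \<delta> + (LINT r|lborel. ?q \<delta> r * ?h r))
      \<longlongrightarrow> LK (K_tilde k K) f s) (at_right 0)" by simp
  moreover have "eventually (\<lambda>\<delta>. trunc_LK (K_tilde k K) f s \<delta> + (LINT r|lborel. ?q \<delta> r * ?h r)
      = (LINT r|lborel. trunc_kernel K \<delta> r * ?h r)) (at_right 0)"
    unfolding eventually_at_right_field
  proof (intro exI[of _ 1] conjI allI impI)
    fix \<delta> :: real assume \<delta>: "0 < \<delta>" "\<delta> < 1"
    have bd: "\<bar>?h r\<bar> \<le> 2 * B" "0 \<le> B" for r using B[of "s + r $ k"] B[of s] by auto
    have i: "integrable lborel (\<lambda>r. trunc_kernel K \<delta> r * (if P r then ?h r else 0))"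
      if [measurable]: "Measurable.pred borel P" for P
      using bd \<delta> by (intro integrable_trunc_kernel_mult[where B = "2 * B"]) auto
    have 1: "integrable lborel (\<lambda>r. (if \<bar>r $ k\<bar> > \<delta> then trunc_kernel K \<delta> r else 0) * ?h r)"
      using i[of "\<lambda>r. \<bar>r $ k\<bar> > \<delta>"]
      by (rule Bochner_Integration.integrable_cong[THEN iffD1, rotated -1]) auto
    have 2: "integrable lborel (\<lambda>r. ?q \<delta> r * ?h r)"
      using i[of "\<lambda>r. \<bar>r $ k\<bar> \<le> \<delta>"]
      by (rule Bochner_Integration.integrable_cong[THEN iffD1, rotated -1]) auto
    show "trunc_LK (K_tilde k K) f s \<delta> + (LINT r|lborel. ?q \<delta> r * ?h r)
      = (LINT r|lborel. trunc_kernel K \<delta> r * ?h r)"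
      unfolding trunc_LK_K_tilde_eq[OF assms(1) B \<delta>(1)] Bochner_Integration.integral_add[OF 1 2, symmetric]
      by (rule Bochner_Integration.integral_cong) auto
  qed simp
  ultimately show ?thesis by (rule Lim_transform_eventually)
qed

lemma ridge_integral_rotate:
  fixes f :: "real \<Rightarrow> real"
  assumes [measurable]: "f \<in> borel_measurable borel" and e: "norm e = 1" and \<delta>: "\<delta> \<ge> 0"
  shows "(LINT r|lborel. trunc_kernel K \<delta> r * f (r \<bullet> e)) = (LINT r|lborel. trunc_kernel K \<delta> r * f (r $ k))"
proof -
  have "norm (axis k 1 :: real ^ 'n) = norm e" using e by (simp add: norm_axis_1)
  then obtain T where T: "orthogonal_transformation T" "T (axis k 1 :: real ^ 'n) = e"
    by (rule orthogonal_transformation_exists)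
  have [measurable]: "trunc_kernel K \<delta> \<in> borel_measurable borel" using \<delta> by simp
  have "T r \<bullet> e = r $ k" for r
  proof -
    have "T r \<bullet> T (axis k 1) = r \<bullet> axis k 1"
      using T(1) unfolding orthogonal_transformation_def by blast
    then show ?thesis by (simp add: T(2) inner_axis)
  qed
  moreover have "trunc_kernel K \<delta> (T r) = trunc_kernel K \<delta> r" for r
    using \<delta> by (intro trunc_kernel_radial orthogonal_transformation_norm T)
  ultimately show ?thesis
    using integral_lborel_orthogonal_affine[OF T(1), of "\<lambda>r. trunc_kernel K \<delta> r * f (r \<bullet> e)" 0]
    by simp
qed

end

section \<open>Comparison at a maximum point\<close>

text \<open>Let \<open>e\<close> be the unit vector from \<open>x\<close> to \<open>y\<close>. When \<open>y\<close> jumps by \<open>r\<close>, let \<open>x\<close> jump by the mirror image of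
  \<open>r\<close>. The two endpoints are then mirror images in the bisecting hyperplane of \<open>x\<close> and \<open>y\<close>, at signed
  distance \<open>s + r \<bullet> e\<close> from it. With \<open>F(r)\<close> the value of \<open>\<Phi>\<close> at the new pair, computed with the odd function
  \<open>f\<close> at the signed distance, minus the maximum \<open>M\<close>, the increments of all terms add up to \<open>F(r)\<close>. On the
  half space of nonnegative signed distance \<open>F \<le> 0\<close> because \<open>M\<close> is a maximum. Reflecting \<open>r\<close> exchanges the
  two endpoints, so that all odd terms cancel in \<open>F(r) + F(\<tau> r)\<close> and only \<open>- 2 M\<close> and the even, nonpositive
  penalty remain. So the weighted integral of \<open>F\<close> is nonpositive, and in the limit this is the claim.
  As \<open>K\<close> is radial, mirroring the jumps of \<open>x\<close> leaves its generator unchanged, and rotating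
  \<open>e\<close> to the \<open>k\<close>-th axis turns the term with \<open>f\<close> into the one-dimensional generator.\<close>

lemma generator_comparison_at_maximum:
  fixes K :: "real ^ 'n::finite \<Rightarrow> real" and k :: 'n and v \<Psi> :: "real ^ 'n \<Rightarrow> real"
    and f :: "real \<Rightarrow> real" and \<epsilon> M :: real
  defines "\<Phi> \<equiv> \<lambda>x y. v y - v x - 2 * f (norm (x - y) / 2) - \<epsilon> * (\<Psi> x + \<Psi> y)"
  assumes K: "radial_decreasing_kernel K"
    and v: "continuous_on UNIV v" "LK_exists K v x" "LK_exists K v y"
    and \<Psi>: "continuous_on UNIV \<Psi>" "LK_exists K \<Psi> x" "LK_exists K \<Psi> y" "\<And>z. \<Psi> z \<ge> 0"
    and f: "continuous_on UNIV f" "\<And>z. \<bar>f z\<bar> \<le> B" "\<And>z. f (- z) = - f z"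
      "\<And>w. \<bar>w\<bar> \<le> 1 \<Longrightarrow> \<bar>f (s + w) + f (s - w) - 2 * f s\<bar> \<le> C * w\<^sup>2"
      "LK_exists (K_tilde k K) f s"
    and s: "s = norm (x - y) / 2" "x \<noteq> y"
    and \<epsilon>: "\<epsilon> \<ge> 0" and M: "\<Phi> x y = M" "M > 0"
    and max: "\<And>x' y'. \<Phi> x' y' \<le> M"
  shows "LK K v y - LK K v x - 2 * LK (K_tilde k K) f s \<le> \<epsilon> * (LK K \<Psi> x + LK K \<Psi> y)"
proof -
  interpret radial_decreasing_kernel K by (rule K)
  define e where "e = (1 / (2 * s)) *\<^sub>R (y - x)"
  have s0: "s > 0" unfolding s(1) using s(2) by simp
  have e: "norm e = 1" using s(2) unfolding e_def s(1) by (simp add: norm_minus_commute)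
  have y: "y = x + (2 * s) *\<^sub>R e" using s0 by (simp add: e_def)
  define \<tau> where "\<tau> r = mirror e r - (2 * s) *\<^sub>R e" for r
  have y\<tau>: "y + \<tau> r = x + mirror e r" for r by (simp add: \<tau>_def y)
  have "mirror e e = - e"
    using scaleR_2[of e] by (simp add: mirror_def unit_inner_self[OF e])
  then have x\<tau>: "x + mirror e (\<tau> r) = y + r" for r
    by (simp add: \<tau>_def y linear_diff[OF linear_mirror[OF e]] linear_scale[OF linear_mirror[OF e]]
        mirror_mirror[OF e])
  have s\<tau>: "s + \<tau> r \<bullet> e = - (s + r \<bullet> e)" for r
    by (simp add: \<tau>_def inner_diff_left mirror_inner[OF e] unit_inner_self[OF e])
  define F where "F r = v (y + r) - v (x + mirror e r) - 2 * f (s + r \<bullet> e)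
     - \<epsilon> * (\<Psi> (x + mirror e r) + \<Psi> (y + r)) - M" for r
  have F_half: "F r \<le> 0" if r: "r \<bullet> e \<ge> - s" for r
  proof -
    have "(x + mirror e r) - (y + r) = (- 2 * (s + r \<bullet> e)) *\<^sub>R e"
      by (simp add: y mirror_def algebra_simps)
    then have dist: "norm ((x + mirror e r) - (y + r)) / 2 = s + r \<bullet> e"
      using r e by simp
    show ?thesis
      using max[of "x + mirror e r" "y + r"] unfolding \<Phi>_def dist by (simp add: F_def)
  qed
  have F_sum: "F r + F (\<tau> r) = - 2 * \<epsilon> * (\<Psi> (x + mirror e r) + \<Psi> (y + r)) - 2 * M" for r
    unfolding F_def y\<tau> x\<tau> s\<tau> f(3) by (simp add: algebra_simps)
  have F_pair: "F r + F (\<tau> r) \<le> - 2 * M" for r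
    unfolding F_sum using \<epsilon> \<Psi>(4)[of "x + mirror e r"] \<Psi>(4)[of "y + r"] by simp
  have F0: "F 0 = 0"
    using M(1) by (simp add: F_def \<Phi>_def s(1) mirror_def)
  have cont_mirror: "continuous_on UNIV (mirror e)"
    unfolding mirror_def by (intro continuous_intros)
  have "continuous_on UNIV F"
    unfolding F_def
    by (intro continuous_intros continuous_on_compose2[OF v(1)] continuous_on_compose2[OF \<Psi>(1)]
        continuous_on_compose2[OF f(1)] cont_mirror) auto
  then have "isCont F 0" by (simp add: continuous_on_eq_continuous_at)
  \<comment> \<open>Near the origin \<open>F\<close> exceeds \<open>- 2 M\<close>, so at the reflected points \<open>F\<close> is negative.\<close>
  then obtain d where d: "d > 0" "\<And>r. norm r < d \<Longrightarrow> \<bar>F r\<bar> < 2 * M"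
    unfolding continuous_at_eps_delta using M(2) F0 by (force simp: dist_norm)
  have [measurable]: "v \<in> borel_measurable borel" "\<Psi> \<in> borel_measurable borel" "f \<in> borel_measurable borel"
    using v(1) \<Psi>(1) f(1) by (auto intro: borel_measurable_continuous_onI)
  let ?k = "trunc_kernel K"
  have mirror_int: "integrable lborel (\<lambda>r. ?k \<delta> r * (g (x + mirror e r) - g x))"
      "(LINT r|lborel. ?k \<delta> r * (g (x + mirror e r) - g x)) = (LINT r|lborel. ?k \<delta> r * (g (x + r) - g x))"
    if [measurable]: "g \<in> borel_measurable borel" and "LK_exists K g x" and \<delta>: "\<delta> > 0" for g \<delta>
  proof -
    note orth = orthogonal_transformation_mirror[OF e]
    have [measurable]: "?k \<delta> \<in> borel_measurable borel" using \<delta> by simp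
    have m: "(\<lambda>r. ?k \<delta> r * (g (x + r) - g x)) \<in> borel_measurable borel" by measurable
    have k: "?k \<delta> (mirror e r) = ?k \<delta> r" for r
      using \<delta> by (intro trunc_kernel_radial orthogonal_transformation_norm orth) auto
    show "(LINT r|lborel. ?k \<delta> r * (g (x + mirror e r) - g x)) = (LINT r|lborel. ?k \<delta> r * (g (x + r) - g x))"
      using integral_lborel_orthogonal_affine[OF orth m, of 0] by (simp add: k)
    show "integrable lborel (\<lambda>r. ?k \<delta> r * (g (x + mirror e r) - g x))"
      using integrable_lborel_orthogonal_affine[OF orth m, of 0] LK_exists_integrable[OF that(2) \<delta>]
      by (simp add: k)
  qed
  let ?I = "\<lambda>g z \<delta>. LINT r|lborel. ?k \<delta> r * (g (z + r) - g z)"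
  let ?J = "\<lambda>\<delta>. LINT r|lborel. ?k \<delta> r * (f (s + r $ k) - f s)"
  have step: "?I v y \<delta> - ?I v x \<delta> - 2 * ?J \<delta> - \<epsilon> * (?I \<Psi> x \<delta> + ?I \<Psi> y \<delta>) \<le> 0"
    if \<delta>: "0 < \<delta>" "\<delta> < d" for \<delta>
  proof -
    have i1: "integrable lborel (\<lambda>r. ?k \<delta> r * (v (y + r) - v y))"
      and i2: "integrable lborel (\<lambda>r. ?k \<delta> r * (\<Psi> (y + r) - \<Psi> y))"
      using v(3) \<Psi>(3) \<delta>(1) by (auto intro: LK_exists_integrable)
    have i3: "integrable lborel (\<lambda>r. ?k \<delta> r * (v (x + mirror e r) - v x))"
      using v(2) \<delta>(1) by (intro mirror_int) auto
    have i4: "integrable lborel (\<lambda>r. ?k \<delta> r * (\<Psi> (x + mirror e r) - \<Psi> x))"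
      using \<Psi>(2) \<delta>(1) by (intro mirror_int) auto
    have i5: "integrable lborel (\<lambda>r. ?k \<delta> r * (f (s + r \<bullet> e) - f s))"
    proof (rule integrable_trunc_kernel_mult[OF \<delta>(1)])
      show "\<bar>f (s + r \<bullet> e) - f s\<bar> \<le> 2 * B" for r using f(2)[of s] f(2)[of "s + r \<bullet> e"] by auto
    qed measurable
    have Feq: "?k \<delta> r * F r = ?k \<delta> r * (v (y + r) - v y) - ?k \<delta> r * (v (x + mirror e r) - v x)
       - 2 * (?k \<delta> r * (f (s + r \<bullet> e) - f s))
       - \<epsilon> * (?k \<delta> r * (\<Psi> (x + mirror e r) - \<Psi> x) + ?k \<delta> r * (\<Psi> (y + r) - \<Psi> y))" for r
      unfolding F_def M(1)[symmetric] \<Phi>_def s(1)[symmetric] by (simp add: algebra_simps)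
    have intF: "integrable lborel (\<lambda>r. ?k \<delta> r * F r)"
      unfolding Feq using i1 i2 i3 i4 i5 by simp
    have "(LINT r|lborel. ?k \<delta> r * F r) = ?I v y \<delta> - ?I v x \<delta> - 2 * ?J \<delta> - \<epsilon> * (?I \<Psi> x \<delta> + ?I \<Psi> y \<delta>)"
      unfolding Feq
      using i1 i2 i3 i4 i5 mirror_int(2)[of v \<delta>] mirror_int(2)[of \<Psi> \<delta>] v(2) \<Psi>(2) \<delta>(1)
        ridge_integral_rotate[OF K _ e, of "\<lambda>w. f (s + w) - f s" \<delta> k] by simp
    moreover have "(LINT r|lborel. ?k \<delta> r * F r) \<le> 0"
    proof (rule reflected_integral_nonpos[OF e s0 _ intF F_half])
      show "F r + F (mirror e r - (2 * s) *\<^sub>R e) \<le> 0" for r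
        using F_pair[of r] M(2) by (simp add: \<tau>_def)
      show "F (mirror e r - (2 * s) *\<^sub>R e) \<le> 0" if "norm r \<le> \<delta>" for r
        using F_pair[of r] d(2)[of r] that \<delta> by (simp add: \<tau>_def)
    qed (use \<delta> in auto)
    ultimately show ?thesis by simp
  qed
  have J: "(?J \<longlongrightarrow> LK (K_tilde k K) f s) (at_right 0)"
    by (rule ridge_principal_value_tendsto[OF K _ f(2) f(4) f(5)]) measurable
  have "((\<lambda>\<delta>. ?I v y \<delta> - ?I v x \<delta> - 2 * ?J \<delta> - \<epsilon> * (?I \<Psi> x \<delta> + ?I \<Psi> y \<delta>)) \<longlongrightarrow>
      LK K v y - LK K v x - 2 * LK (K_tilde k K) f s - \<epsilon> * (LK K \<Psi> x + LK K \<Psi> y)) (at_right 0)"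
    by (intro tendsto_intros LK_exists_tendsto J v \<Psi>)
  then have "LK K v y - LK K v x - 2 * LK (K_tilde k K) f s - \<epsilon> * (LK K \<Psi> x + LK K \<Psi> y) \<le> 0"
  proof (rule tendsto_upperbound)
    show "eventually (\<lambda>\<delta>. ?I v y \<delta> - ?I v x \<delta> - 2 * ?J \<delta> - \<epsilon> * (?I \<Psi> x \<delta> + ?I \<Psi> y \<delta>) \<le> 0) (at_right 0)"
      unfolding eventually_at_right_field using step d(1) by blast
  qed simp
  then show ?thesis by simp
qed

section \<open>Continuity and existence of the maximum\<close>

text \<open>Separate continuity suffices in the presence of monotonicity: near \<open>(r\<^sub>0, t\<^sub>0)\<close> the value \<open>f r t\<close> lies
  between \<open>f r\<^sub>1 t\<close> and \<open>f r\<^sub>2 t\<close> for fixed \<open>r\<^sub>1 < r\<^sub>0 < r\<^sub>2\<close>, and these depend continuously on \<open>t\<close>. It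
  yields the joint continuity of the modulus \<open>\<phi>\<close> from its regularity in each variable.\<close>

lemma continuous_on_Times_of_mono_slices:
  fixes f :: "real \<Rightarrow> 'b::topological_space \<Rightarrow> real"
  assumes mono: "\<And>t. t \<in> S \<Longrightarrow> mono (\<lambda>r. f r t)"
    and cont1: "\<And>t. t \<in> S \<Longrightarrow> continuous_on UNIV (\<lambda>r. f r t)"
    and cont2: "\<And>r. continuous_on S (f r)"
  shows "continuous_on (UNIV \<times> S) (\<lambda>z. f (fst z) (snd z))"
  unfolding continuous_on_def
proof
  fix z :: "real \<times> 'b" assume z: "z \<in> UNIV \<times> S"
  obtain r0 t0 where z_eq: "z = (r0, t0)" and t0: "t0 \<in> S" using z by (cases z) auto
  let ?at = "at (r0, t0) within UNIV \<times> S"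
  have S: "eventually (\<lambda>w. snd w \<in> S) ?at"
    by (auto simp: eventually_at_filter intro!: always_eventually)
  have fst: "(fst \<longlongrightarrow> r0) ?at" by (rule tendsto_eq_intros | simp)+
  have slice: "((\<lambda>w. f r (snd w)) \<longlongrightarrow> f r t0) ?at" for r
  proof -
    have "continuous_on (UNIV \<times> S) (\<lambda>w :: real \<times> 'b. f r (snd w))"
      by (rule continuous_on_compose2[OF cont2]) (auto intro: continuous_intros)
    then show ?thesis using t0 by (auto simp: continuous_on_def)
  qed
  have r: "((\<lambda>r. f r t0) \<longlongrightarrow> f r0 t0) (at r0)"
    using cont1[OF t0] by (simp add: continuous_on_def)
  have "((\<lambda>w. f (fst w) (snd w)) \<longlongrightarrow> f r0 t0) ?at"
  proof (rule order_tendstoI)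
    fix a assume a: "a < f r0 t0"
    have "eventually (\<lambda>r. a < f r t0 \<and> r < r0) (at_left r0)"
      using order_tendstoD(1)[OF filterlim_at_split[THEN iffD1, OF r, THEN conjunct1] a]
      by (intro eventually_conj) (auto simp: eventually_at_filter)
    from eventually_happens'[OF trivial_limit_at_left_real this]
    obtain r1 where r1: "a < f r1 t0" "r1 < r0" by blast
    show "eventually (\<lambda>w. a < f (fst w) (snd w)) ?at"
      using S order_tendstoD(1)[OF fst r1(2)] order_tendstoD(1)[OF slice r1(1)]
    proof eventually_elim
      case (elim w)
      then have "f r1 (snd w) \<le> f (fst w) (snd w)" using mono[of "snd w"] by (simp add: mono_def)
      then show ?case using elim by simp
    qed
  next
    fix a assume a: "f r0 t0 < a"
    have "eventually (\<lambda>r. f r t0 < a \<and> r0 < r) (at_right r0)"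
      using order_tendstoD(2)[OF filterlim_at_split[THEN iffD1, OF r, THEN conjunct2] a]
      by (intro eventually_conj) (auto simp: eventually_at_filter)
    from eventually_happens'[OF trivial_limit_at_right_real this]
    obtain r1 where r1: "f r1 t0 < a" "r0 < r1" by blast
    show "eventually (\<lambda>w. f (fst w) (snd w) < a) ?at"
      using S order_tendstoD(2)[OF fst r1(2)] order_tendstoD(2)[OF slice r1(1)]
    proof eventually_elim
      case (elim w)
      then have "f (fst w) (snd w) \<le> f r1 (snd w)" using mono[of "snd w"] by (simp add: mono_def)
      then show ?case using elim by simp
    qed
  qed
  then show "((\<lambda>z. f (fst z) (snd z)) \<longlongrightarrow> f (fst z) (snd z)) (at z within UNIV \<times> S)"
    by (simp add: z_eq)
qed

lemma C11_loc_continuous_on: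
  assumes "C11_loc f"
  shows "continuous_on UNIV f"
proof -
  obtain g where "\<And>x. GDERIV f x :> g x" using assms unfolding C11_loc_def by blast
  then show ?thesis
    unfolding gderiv_def using has_derivative_continuous continuous_at_imp_continuous_on by blast
qed

lemma coercive_attains_maximum:
  fixes \<Phi> :: "'a::{real_normed_vector, heine_borel} \<times> real \<Rightarrow> real"
  assumes cont: "continuous_on (UNIV \<times> {a..b}) \<Phi>" and t0: "t0 \<in> {a..b}"
    and out: "\<And>z t. t \<in> {a..b} \<Longrightarrow> norm z > R \<Longrightarrow> \<Phi> (z, t) < \<Phi> (z0, t0)"
  shows "\<exists>z. \<exists>t\<in>{a..b}. \<forall>z'. \<forall>t'\<in>{a..b}. \<Phi> (z', t') \<le> \<Phi> (z, t)"
proof -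
  let ?C = "cball (0::'a) (max R (norm z0)) \<times> {a..b}"
  have "compact ?C" by (intro compact_Times) auto
  moreover have z0: "(z0, t0) \<in> ?C" using t0 by simp
  moreover have "continuous_on ?C \<Phi>" by (rule continuous_on_subset[OF cont]) auto
  ultimately obtain p where p: "p \<in> ?C" "\<And>q. q \<in> ?C \<Longrightarrow> \<Phi> q \<le> \<Phi> p"
    using continuous_attains_sup[of ?C \<Phi>] by (metis empty_iff)
  show ?thesis
  proof (intro exI[of _ "fst p"] bexI[of _ "snd p"] allI ballI)
    show "snd p \<in> {a..b}" using p(1) by auto
    fix z' t' assume t': "t' \<in> {a..b}"
    show "\<Phi> (z', t') \<le> \<Phi> (fst p, snd p)"
    proof (cases "(z', t') \<in> ?C")
      case True
      then show ?thesis using p(2) by simp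
    next
      case False
      then have "norm z' > R" using t' by auto
      then have "\<Phi> (z', t') < \<Phi> (z0, t0)" by (rule out[OF t'])
      then show ?thesis using p(2)[OF z0] by simp
    qed
  qed
qed

lemma odd_ext_minus: "f 0 = 0 \<Longrightarrow> odd_ext f (- z) = - odd_ext f z"
  by (auto simp: odd_ext_def)

lemma odd_ext_abs_le:
  assumes mono: "mono_on {0..} f" and nonneg: "\<And>r. r \<ge> 0 \<Longrightarrow> f r \<ge> 0"
    and lim: "(odd_ext f \<longlongrightarrow> L) at_top"
  shows "\<bar>odd_ext f z\<bar> \<le> L"
proof -
  have "f r \<le> L" if r: "r \<ge> 0" for r
  proof (rule tendsto_lowerbound[OF lim])
    show "eventually (\<lambda>z. f r \<le> odd_ext f z) at_top"
      using eventually_ge_at_top[of r]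
      by eventually_elim (use r in \<open>auto simp: odd_ext_def intro: mono_onD[OF mono]\<close>)
  qed simp
  then show ?thesis using nonneg[of z] nonneg[of "- z"] by (auto simp: odd_ext_def)
qed

section \<open>The maximum principle\<close>

theorem theorem2p16:
  fixes K :: "real ^ 'n::finite \<Rightarrow> real"
    and k :: 'n
    and u :: "real ^ 'n \<Rightarrow> real \<Rightarrow> real"
    and \<phi> :: "real \<Rightarrow> real \<Rightarrow> real"
  assumes K_nonneg: "\<And>r. r \<noteq> 0 \<Longrightarrow> K r \<ge> 0"
    and K_measurable: "set_borel_measurable borel (- {0}) K"
    and K_even: "\<And>r. r \<noteq> 0 \<Longrightarrow> K (- r) = K r"
    and K_radial: "\<And>r s. r \<noteq> 0 \<Longrightarrow> s \<noteq> 0 \<Longrightarrow> norm r = norm s \<Longrightarrow> K r = K s"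
    and K_decreasing: "\<And>r s. r \<noteq> 0 \<Longrightarrow> s \<noteq> 0 \<Longrightarrow> norm r \<le> norm s \<Longrightarrow> K s \<le> K r"
    and K_finite: "(\<integral>\<^sup>+r\<in>- {0}. ennreal (min 1 ((norm r)\<^sup>2) * K r) \<partial>lborel) < \<infinity>"
    and u_continuous: "continuous_on (UNIV \<times> {0..}) (\<lambda>(x, t). u x t)"
    and u_bounded: "\<And>x t. t \<ge> 0 \<Longrightarrow> \<bar>u x t\<bar> \<le> 1"
    and u_C11: "\<And>t. t > 0 \<Longrightarrow> C11_loc (\<lambda>x. u x t)"
    and u_LK_exists: "\<And>x t. t > 0 \<Longrightarrow> LK_exists K (\<lambda>y. u y t) x"
    and u_equation: "\<And>x t. t > 0 \<Longrightarrow>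
          ((\<lambda>\<tau>. u x \<tau>) has_real_derivative LK K (\<lambda>y. u y t) x) (at t)"
    and phi_nonneg: "\<And>r t. r \<ge> 0 \<Longrightarrow> t \<ge> 0 \<Longrightarrow> \<phi> r t \<ge> 0"
    and phi_C1: "\<And>t. t \<ge> 0 \<Longrightarrow> C1_halfline (\<lambda>r. \<phi> r t)"
    and phi_increasing: "\<And>t. t \<ge> 0 \<Longrightarrow> strict_mono_on {0..} (\<lambda>r. \<phi> r t)"
    and phi_zero: "\<And>t. t \<ge> 0 \<Longrightarrow> \<phi> 0 t = 0"
    and phi_initial_modulus: "is_modulus (\<lambda>r. \<phi> r 0) (\<lambda>x. u x 0)"
    and phi_initial_trace: "\<And>r. r \<ge> 0 \<Longrightarrow> ((\<lambda>t. \<phi> r t) \<longlongrightarrow> \<phi> r 0) (at_right 0)"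
    and phi_C11: "\<And>t. t > 0 \<Longrightarrow> C11_loc (odd_ext (\<lambda>r. \<phi> r t))"
    and phi_at_top: "\<And>t. t > 0 \<Longrightarrow> (odd_ext (\<lambda>r. \<phi> r t) \<longlongrightarrow> 1) at_top"
    and phi_at_bot: "\<And>t. t > 0 \<Longrightarrow> (odd_ext (\<lambda>r. \<phi> r t) \<longlongrightarrow> - 1) at_bot"
    and phi_LK_exists: "\<And>s t. t > 0 \<Longrightarrow> LK_exists (K_tilde k K) (odd_ext (\<lambda>r. \<phi> r t)) s"
    and phi_equation: "\<And>s t. t > 0 \<Longrightarrow>
          ((\<lambda>\<tau>. odd_ext (\<lambda>r. \<phi> r \<tau>) s) has_real_derivative
             LK (K_tilde k K) (odd_ext (\<lambda>r. \<phi> r t)) s) (at t)"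
    and Psi: "\<exists>(\<Psi> :: real ^ 'n \<Rightarrow> real) (K0 :: real).
          C_infinity \<Psi> \<and>
          (\<forall>x y. norm x = norm y \<longrightarrow> \<Psi> x = \<Psi> y) \<and>
          (\<forall>x. \<Psi> x \<ge> 1) \<and>
          filterlim \<Psi> at_top at_infinity \<and>
          (\<forall>x. LK_exists K \<Psi> x \<and> LK K \<Psi> x \<le> K0)"
  shows "\<forall>t\<ge>0. is_modulus (\<lambda>r. \<phi> r t) (\<lambda>x. u x t)"
proof (intro allI impI)
  have kernel: "radial_decreasing_kernel K"
    using K_nonneg K_measurable K_decreasing K_finite by unfold_locales auto
  obtain \<Psi> :: "real ^ 'n \<Rightarrow> real" and K0 :: real where "C_infinity \<Psi>"
    and \<Psi>1: "\<And>x. \<Psi> x \<ge> 1" and \<Psi>lim: "filterlim \<Psi> at_top at_infinity"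
    and \<Psi>ex: "\<And>x. LK_exists K \<Psi> x" and \<Psi>le: "\<And>x. LK K \<Psi> x \<le> K0"
    using Psi by blast
  then have \<Psi>cont: "continuous_on UNIV \<Psi>"
    unfolding C_infinity_def by (metis C_k.simps(1))
  have slope: "continuous_on {0..} (\<lambda>r. \<phi> r t)" if "t \<ge> 0" for t
    using phi_C1[OF that] unfolding C1_halfline_def
    by (auto simp: continuous_on_eq_continuous_within intro: DERIV_continuous)
  have mono: "mono_on {0..} (\<lambda>r. \<phi> r t)" if "t \<ge> 0" for t
    using phi_increasing[OF that] by (rule strict_mono_on_imp_mono_on)
  have phi_deriv: "((\<lambda>\<tau>. \<phi> r \<tau>) has_real_derivative LK (K_tilde k K) (odd_ext (\<lambda>r. \<phi> r t)) r) (at t)"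
    if "t > 0" "r \<ge> 0" for r t
    using phi_equation[OF that(1), of r] that(2) by (simp add: odd_ext_def)
  \<comment> \<open>Extending \<open>\<phi>(\<cdot>, t)\<close> by 0 to negative arguments keeps it monotone and continuous on the whole line.\<close>
  define g where "g r t = \<phi> (max r 0) t" for r t
  have g_cont: "continuous_on (UNIV \<times> {0..}) (\<lambda>z. g (fst z) (snd z))"
  proof (rule continuous_on_Times_of_mono_slices)
    fix t :: real assume t: "t \<in> {0..}"
    show "mono (\<lambda>r. g r t)"
      unfolding g_def using t by (intro monoI mono_onD[OF mono]) auto
    show "continuous_on UNIV (\<lambda>r. g r t)"
      unfolding g_def using t
      by (intro continuous_on_compose2[OF slope] continuous_intros) auto
  next
    fix r :: real
    show "continuous_on {0..} (g r)"
      unfolding continuous_on_def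
    proof
      fix t :: real assume t: "t \<in> {0..}"
      show "(g r \<longlongrightarrow> g r t) (at t within {0..})"
      proof (cases "t = 0")
        case True
        then show ?thesis
          using phi_initial_trace[of "max r 0"] by (simp add: g_def[abs_def] at_within_Ici_at_right)
      next
        case False
        then have "isCont (g r) t"
          using t DERIV_isCont[OF phi_deriv[of t "max r 0"]] by (simp add: g_def[abs_def])
        then show ?thesis
          by (simp add: isCont_def tendsto_within_subset[OF _ subset_UNIV])
      qed
    qed
  qed
  have main: "u y T - u x T \<le> 2 * \<phi> (norm (y - x) / 2) T" if T: "T > 0" for x y T
  proof (rule ccontr)
    assume contra: "\<not> ?thesis"
    define w where "w = u y T - u x T - 2 * \<phi> (norm (y - x) / 2) T"
    have w: "w > 0" using contra by (simp add: w_def)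
    \<comment> \<open>The time penalty uses up half of the violation \<open>w\<close> at \<open>(x, y, T)\<close>, the space penalty at most a quarter. The
        parameter \<open>\<epsilon>\<close> is chosen after \<open>\<eta>\<close>, so small that the generator of the space penalty stays below \<open>\<eta>\<close>.\<close>
    define \<eta> where "\<eta> = w / (2 * T)"
    have \<eta>: "\<eta> > 0" "\<eta> * T = w / 2" using w T by (simp_all add: \<eta>_def)
    define \<epsilon> where "\<epsilon> = min (w / (4 * (\<Psi> x + \<Psi> y))) (\<eta> / (2 * \<bar>K0\<bar> + 1) / 2)"
    have \<Psi>pos: "\<Psi> x + \<Psi> y > 0" using \<Psi>1[of x] \<Psi>1[of y] by simp
    have \<epsilon>: "\<epsilon> > 0" unfolding \<epsilon>_def using w \<Psi>pos \<eta> by auto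
    have \<epsilon>w: "\<epsilon> * (\<Psi> x + \<Psi> y) \<le> w / 4"
    proof -
      have "\<epsilon> \<le> w / (4 * (\<Psi> x + \<Psi> y))" by (simp add: \<epsilon>_def)
      then show ?thesis using \<Psi>pos by (simp add: field_simps)
    qed
    have \<epsilon>K: "\<epsilon> * (2 * K0) < \<eta>"
    proof -
      have "\<epsilon> * (2 * K0) \<le> \<epsilon> * (2 * \<bar>K0\<bar> + 1)" using \<epsilon> by (intro mult_left_mono) auto
      also have "\<dots> \<le> (\<eta> / (2 * \<bar>K0\<bar> + 1) / 2) * (2 * \<bar>K0\<bar> + 1)"
        by (intro mult_right_mono) (auto simp: \<epsilon>_def)
      also have "\<dots> = \<eta> / 2" by (simp add: field_simps)
      finally show ?thesis using \<eta>(1) by simp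
    qed
    define \<Phi> where "\<Phi> = (\<lambda>((x', y'), t). u y' t - u x' t - 2 * g (norm (x' - y') / 2) t
       - \<epsilon> * (\<Psi> x' + \<Psi> y') - \<eta> * t)"
    have \<Phi>0: "\<Phi> ((x, y), T) > 0"
      using w \<eta>(2) \<epsilon>w by (simp add: \<Phi>_def g_def w_def norm_minus_commute)
    have \<Phi>_cont: "continuous_on (UNIV \<times> {0..T}) \<Phi>"
    proof -
      have u: "continuous_on (UNIV \<times> {0..}) (\<lambda>z. u (fst z) (snd z))"
        using u_continuous by (simp add: split_beta')
      have "continuous_on (UNIV \<times> {0..T}) (\<lambda>z :: ((real ^ 'n) \<times> (real ^ 'n)) \<times> real. u (h (fst z)) (snd z))"
        if "continuous_on UNIV h" for h
        by (rule continuous_on_compose2[OF u, where f = "\<lambda>z. (h (fst z), snd z)", simplified])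
          (auto intro!: continuous_intros continuous_on_compose2[OF that])
      note this[OF continuous_on_fst[OF continuous_on_id]] this[OF continuous_on_snd[OF continuous_on_id]]
      then have 1: "continuous_on (UNIV \<times> {0..T}) (\<lambda>z :: ((real ^ 'n) \<times> (real ^ 'n)) \<times> real. u (fst (fst z)) (snd z))"
        "continuous_on (UNIV \<times> {0..T}) (\<lambda>z :: ((real ^ 'n) \<times> (real ^ 'n)) \<times> real. u (snd (fst z)) (snd z))"
        by simp_all
      have 2: "continuous_on (UNIV \<times> {0..T}) (\<lambda>z :: ((real ^ 'n) \<times> (real ^ 'n)) \<times> real.
          g (norm (fst (fst z) - snd (fst z)) / 2) (snd z))"
        by (rule continuous_on_compose2[OF g_cont,
              where f = "\<lambda>z. (norm (fst (fst z) - snd (fst z)) / 2, snd z)", simplified])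
          (auto intro!: continuous_intros)
      show ?thesis
        unfolding \<Phi>_def split_beta'
        by (intro continuous_intros 1 2 continuous_on_compose2[OF \<Psi>cont]) auto
    qed
    obtain b where b: "\<And>z. norm z \<ge> b \<Longrightarrow> \<Psi> z > 2 / \<epsilon>"
      using \<Psi>lim unfolding filterlim_at_top_dense eventually_at_infinity by blast
    have far: "\<Phi> (z, t) < \<Phi> ((x, y), T)" if t: "t \<in> {0..T}" and z: "norm z > 2 * \<bar>b\<bar>" for z t
    proof -
      obtain x' y' where z_eq: "z = (x', y')" by (cases z)
      have "norm x' \<ge> b \<or> norm y' \<ge> b"
        using z norm_Pair_le[of x' y'] by (auto simp: z_eq)
      then have "\<Psi> x' + \<Psi> y' > 2 / \<epsilon>"
        using b[of x'] b[of y'] \<Psi>1[of x'] \<Psi>1[of y'] by auto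
      then have "\<epsilon> * (\<Psi> x' + \<Psi> y') > 2" using \<epsilon> by (simp add: field_simps)
      moreover have "g (norm (x' - y') / 2) t \<ge> 0" using t phi_nonneg by (simp add: g_def)
      moreover have "\<eta> * t \<ge> 0" using t \<eta>(1) by simp
      ultimately show ?thesis
        using u_bounded[of t x'] u_bounded[of t y'] t \<Phi>0 by (simp add: z_eq \<Phi>_def)
    qed
    have "T \<in> {0..T}" using T by simp
    then have "\<exists>z. \<exists>t\<in>{0..T}. \<forall>z'. \<forall>t'\<in>{0..T}. \<Phi> (z', t') \<le> \<Phi> (z, t)"
      using far by (rule coercive_attains_maximum[OF \<Phi>_cont])
    then obtain z1 t1 where t1: "t1 \<in> {0..T}"
      and max1: "\<And>z' t'. t' \<in> {0..T} \<Longrightarrow> \<Phi> (z', t') \<le> \<Phi> (z1, t1)"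
      by blast
    obtain x1 y1 where z1: "z1 = (x1, y1)" by (cases z1)
    have pos: "\<Phi> ((x1, y1), t1) > 0"
      using max1[of T "(x, y)"] \<Phi>0 T by (simp add: z1)
    have pen: "\<epsilon> * (\<Psi> x1 + \<Psi> y1) > 0"
      using \<epsilon> \<Psi>1[of x1] \<Psi>1[of y1] by simp
    have \<eta>t: "\<eta> * t1 \<ge> 0" using t1 \<eta>(1) by simp
    have "t1 \<noteq> 0"
    proof
      assume t1_0: "t1 = 0"
      have "\<bar>u y1 0 - u x1 0\<bar> \<le> 2 * \<phi> (norm (y1 - x1) / 2) 0"
        using phi_initial_modulus unfolding is_modulus_def by blast
      moreover have "u y1 0 - u x1 0 - 2 * \<phi> (norm (y1 - x1) / 2) 0 - \<epsilon> * (\<Psi> x1 + \<Psi> y1) > 0"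
        using pos by (simp add: t1_0 \<Phi>_def g_def norm_minus_commute)
      ultimately show False using pen by linarith
    qed
    then have t1': "t1 > 0" using t1 by simp
    have ne: "x1 \<noteq> y1"
      using pos pen \<eta>t phi_zero[of t1] t1' by (auto simp: \<Phi>_def g_def)
    define s where "s = norm (x1 - y1) / 2"
    have s: "s \<ge> 0" by (simp add: s_def)
    let ?f = "odd_ext (\<lambda>r. \<phi> r t1)"
    obtain C where C: "\<And>v. \<bar>v\<bar> \<le> 1 \<Longrightarrow> \<bar>?f (s + v) + ?f (s - v) - 2 * ?f s\<bar> \<le> C * v\<^sup>2"
      using C11_loc_second_difference[OF phi_C11[OF t1'], of s] by blast
    have fg: "?f (norm (x' - y') / 2) = g (norm (x' - y') / 2) t1" for x' y' :: "real ^ 'n"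
      by (simp add: odd_ext_def g_def)
    \<comment> \<open>At the fixed time \<open>t1\<close> the time penalty is a constant, which is moved into the maximum value \<open>M\<close>.\<close>
    have "LK K (\<lambda>z. u z t1) y1 - LK K (\<lambda>z. u z t1) x1 - 2 * LK (K_tilde k K) ?f s
        \<le> \<epsilon> * (LK K \<Psi> x1 + LK K \<Psi> y1)"
    proof (rule generator_comparison_at_maximum[where B = 1 and C = C and M = "\<Phi> ((x1, y1), t1) + \<eta> * t1"])
      show "radial_decreasing_kernel K" by (rule kernel)
      show "continuous_on UNIV (\<lambda>z. u z t1)" by (rule C11_loc_continuous_on[OF u_C11[OF t1']])
      show "continuous_on UNIV ?f" by (rule C11_loc_continuous_on[OF phi_C11[OF t1']])
      show "\<bar>?f z\<bar> \<le> 1" for z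
        using t1' by (intro odd_ext_abs_le mono phi_nonneg phi_at_top) auto
      show "?f (- z) = - ?f z" for z
        by (rule odd_ext_minus) (use phi_zero t1' in auto)
      show "\<Phi> ((x1, y1), t1) + \<eta> * t1 > 0" using pos \<eta>t by simp
      show "\<Psi> z \<ge> 0" for z using \<Psi>1[of z] by simp
      show "u y1 t1 - u x1 t1 - 2 * ?f (norm (x1 - y1) / 2) - \<epsilon> * (\<Psi> x1 + \<Psi> y1)
          = \<Phi> ((x1, y1), t1) + \<eta> * t1"
        by (simp add: \<Phi>_def fg)
      show "u y' t1 - u x' t1 - 2 * ?f (norm (x' - y') / 2) - \<epsilon> * (\<Psi> x' + \<Psi> y')
          \<le> \<Phi> ((x1, y1), t1) + \<eta> * t1" for x' y'
        using max1[OF t1, of "(x', y')"] by (simp add: z1 \<Phi>_def fg)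
      show "\<bar>?f (s + v) + ?f (s - v) - 2 * ?f s\<bar> \<le> C * v\<^sup>2" if "\<bar>v\<bar> \<le> 1" for v
        using that by (rule C)
    qed (use \<epsilon> ne t1' s_def \<Psi>cont \<Psi>ex u_LK_exists phi_LK_exists in auto)
    also have "\<dots> \<le> \<epsilon> * (2 * K0)"
      using \<Psi>le[of x1] \<Psi>le[of y1] \<epsilon> by (intro mult_left_mono) auto
    finally have neg: "LK K (\<lambda>z. u z t1) y1 - LK K (\<lambda>z. u z t1) x1 - 2 * LK (K_tilde k K) ?f s - \<eta> < 0"
      using \<epsilon>K by simp
    have "((\<lambda>t. u y1 t - u x1 t - 2 * \<phi> s t - \<epsilon> * (\<Psi> x1 + \<Psi> y1) - \<eta> * t) has_real_derivative
        (LK K (\<lambda>z. u z t1) y1 - LK K (\<lambda>z. u z t1) x1 - 2 * LK (K_tilde k K) ?f s - \<eta>)) (at t1)"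
      by (rule derivative_eq_intros u_equation[OF t1'] phi_deriv[OF t1' s] refl | simp)+
    then have "((\<lambda>t. \<Phi> ((x1, y1), t)) has_real_derivative
        (LK K (\<lambda>z. u z t1) y1 - LK K (\<lambda>z. u z t1) x1 - 2 * LK (K_tilde k K) ?f s - \<eta>)) (at t1)"
      by (simp add: \<Phi>_def g_def s_def)
    \<comment> \<open>Only earlier times are compared, so the maximum may lie at the final time \<open>T\<close>.\<close>
    from DERIV_neg_dec_left[OF this neg] obtain d where d: "d > 0"
      "\<And>h. 0 < h \<Longrightarrow> h < d \<Longrightarrow> \<Phi> ((x1, y1), t1) < \<Phi> ((x1, y1), t1 - h)"
      by blast
    have "\<Phi> ((x1, y1), t1) < \<Phi> ((x1, y1), t1 - min (d / 2) t1)"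
      using d(1) t1' by (intro d(2)) auto
    moreover have "t1 - min (d / 2) t1 \<in> {0..T}" using t1 d(1) by auto
    ultimately show False using max1[of "t1 - min (d / 2) t1" "(x1, y1)"] by (simp add: z1)
  qed
  fix t :: real assume t: "t \<ge> 0"
  show "is_modulus (\<lambda>r. \<phi> r t) (\<lambda>x. u x t)"
  proof (cases "t = 0")
    case True
    then show ?thesis using phi_initial_modulus by simp
  next
    case False
    then have "\<bar>u y t - u x t\<bar> \<le> 2 * \<phi> (norm (y - x) / 2) t" for x y
      using main[of t y x] main[of t x y] t by (simp add: abs_le_iff norm_minus_commute)
    moreover have "continuous (at 0 within {0..}) (\<lambda>r. \<phi> r t)"
      using slope[OF t] by (simp add: continuous_on_eq_continuous_within)
    ultimately show ?thesis
      unfolding is_modulus_def using phi_nonneg phi_zero t by auto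
  qed
qed

end
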